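(* Let $N\ge 2$ and let $\varepsilon$ be a completely positive trace-preserving map on $N\times N$ density matrices (a quantum channel from a sender A to a receiver B) of maximal rank $N^2$, i.e. any Kraus (operator-sum) representation of $\varepsilon$ requires $N^2$ Kraus operators. Consider protocols in which $\varepsilon$ is used exactly once, of the following form. A and B share an auxiliary pure state $\vert\psi\rangle^{\mathrm{ab}}=\sum_{i=0}^{P-1}\mu_i\vert i\rangle^{\mathrm a}\otimes\vert i\rangle^{\mathrm b}$ (Schmidt form, $\mu_i\ge 0$, $\sum_i\mu_i^2=1$), A performs local operations on the input system A together with her ancilla a, with outcomes $\eta=0,\dots,M-1$ (described by operators $L^{\mathrm{Aa}}_\eta=\Pi^{\mathrm{Aa}}_\eta U^{\mathrm{Aa}}_\eta$, $U$ unitary, $\Pi$ projections), sends $\eta$ to B over a noiseless classical channel, the system A is sent through $\varepsilon$ (arriving as B), and B performs local operations $L^{\mathrm{Bb}}_{\eta\eta'}$ on B together with his ancilla b; the ancillae are finally discarded, giving $$\tilde\varepsilon[\rho^{\mathrm A}]=\sum_{\eta=0}^{M-1}\mathrm{Tr}_{\mathrm{ab}}\, L^{\mathrm{Bb}}_{\eta\eta'}\,\varepsilon\!\left[L^{\mathrm{Aa}}_\eta\,(\rho^{\mathrm A}\otimes\vert\psi\rangle^{\mathrm{ab}}\langle\psi\vert)\,L^{\mathrm{Aa}\dagger}_\eta\right]L^{\mathrm{Bb}\dagger}_{\eta\eta'} ,$$ where $\varepsilon$ acts on A. Call such a protocol deterministic and faithful if $\sum_\eta L^{\mathrm{Aa}\dagger}_\eta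 L^{\mathrm{Aa}}_\eta=\sum_\eta L^{\mathrm{Aa}}_\eta L^{\mathrm{Aa}\dagger}_\eta=I$, each $L^{\mathrm{Bb}}_{\eta\eta'}$ is unitary and independent of $\eta'$, and $\tilde\varepsilon[\rho^{\mathrm A}]=\rho^{\mathrm A}$ for every state $\rho^{\mathrm A}$. Then the resources of quantum teleportation, namely classical communication from A to B and a maximally entangled shared state of two $N$-level systems, are necessary and sufficient for the existence of such a deterministic and faithful protocol. Precisely: (i) if A and B share a maximally entangled state $\frac{1}{\sqrt N}\sum_{i=0}^{N-1}\vert i\rangle\otimes\vert i\rangle$ and can use one-way classical communication, a deterministic and faithful protocol exists; (ii) every deterministic and faithful protocol uses classical communication (i.e. $M>1$), and its shared state has Schmidt rank $P\ge N$, is maximally entangled ($\mu_i=1/\sqrt N$ for all $i$) when $P=N$, and can be transformed by local operations and classical communication into a maximally entangled state of two $N$-level systems when $P>N$.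
   Context: Systems: A denotes the input of the channel (held by the sender), B its output (held by the receiver); a and b denote auxiliary systems (ancillae) held by sender and receiver respectively. "Local operations" means unitary transformations and projective measurements on a party's own systems (including ancillae); "LOCC" means local operations together with classical communication. The rank of a channel is the minimal number of Kraus operators in an operator-sum representation. *)

theory Defs
  imports Complex_Main "Jordan_Normal_Form.Matrix"
begin

definition adj :: "complex mat \<Rightarrow> complex mat" where
  "adj A = mat (dim_col A) (dim_row A) (\<lambda>(i,j). cnj (A $$ (j,i)))"

definition msum :: "nat \<Rightarrow> nat \<Rightarrow> nat \<Rightarrow> (nat \<Rightarrow> complex mat) \<Rightarrow> complex mat" where
  "msum r c k F = mat r c (\<lambda>(i,j). \<Sum>t<k. F t $$ (i,j))"

definition mtrace :: "complex mat \<Rightarrow> complex" where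
  "mtrace A = (\<Sum>i<dim_row A. A $$ (i,i))"

text \<open>Kronecker (tensor) product; index of (i,k) is i * dim B + k.\<close>
definition kron :: "complex mat \<Rightarrow> complex mat \<Rightarrow> complex mat" where
  "kron A B = mat (dim_row A * dim_row B) (dim_col A * dim_col B)
     (\<lambda>(r,c). A $$ (r div dim_row B, c div dim_col B) * B $$ (r mod dim_row B, c mod dim_col B))"

definition unitary_mat :: "nat \<Rightarrow> complex mat \<Rightarrow> bool" where
  "unitary_mat n U \<longleftrightarrow> U \<in> carrier_mat n n \<and> U * adj U = 1\<^sub>m n \<and> adj U * U = 1\<^sub>m n"

definition projection_mat :: "nat \<Rightarrow> complex mat \<Rightarrow> bool" where
  "projection_mat n Q \<longleftrightarrow> Q \<in> carrier_mat n n \<and> Q * Q = Q \<and> adj Q = Q"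

definition psd :: "nat \<Rightarrow> complex mat \<Rightarrow> bool" where
  "psd n A \<longleftrightarrow> A \<in> carrier_mat n n \<and>
     (\<forall>v \<in> carrier_vec n. let q = (\<Sum>i<n. \<Sum>j<n. cnj (v $ i) * A $$ (i,j) * v $ j)
                           in Im q = 0 \<and> Re q \<ge> 0)"

definition density :: "nat \<Rightarrow> complex mat \<Rightarrow> bool" where
  "density n \<rho> \<longleftrightarrow> psd n \<rho> \<and> mtrace \<rho> = 1"

section \<open>Systems ordered as a (dim p), A/B (dim n), b (dim q)\<close>

text \<open>Basis index of (a,i,b) is (a*n+i)*q+b. The map \<epsilon> on n x n matrices acts on the
  middle factor: (id_p \<otimes> \<epsilon> \<otimes> id_q).\<close>
definition chan_mid :: "nat \<Rightarrow> nat \<Rightarrow> nat \<Rightarrow> (complex mat \<Rightarrow> complex mat) \<Rightarrow> complex mat \<Rightarrow> complex mat" where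
  "chan_mid p n q \<epsilon> X = mat (p*n*q) (p*n*q) (\<lambda>(r,c).
     \<epsilon> (mat n n (\<lambda>(i,j). X $$ (((r div (n*q)) * n + i) * q + r mod q,
                              ((c div (n*q)) * n + j) * q + c mod q)))
       $$ ((r div q) mod n, (c div q) mod n))"

definition ptrace_outer :: "nat \<Rightarrow> nat \<Rightarrow> nat \<Rightarrow> complex mat \<Rightarrow> complex mat" where
  "ptrace_outer p n q X = mat n n (\<lambda>(i,j). \<Sum>a<p. \<Sum>b<q. X $$ ((a*n+i)*q+b, (a*n+j)*q+b))"

definition cptp :: "nat \<Rightarrow> (complex mat \<Rightarrow> complex mat) \<Rightarrow> bool" where
  "cptp n \<epsilon> \<longleftrightarrow>
     (\<forall>X \<in> carrier_mat n n. \<epsilon> X \<in> carrier_mat n n) \<and>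
     (\<forall>X \<in> carrier_mat n n. \<forall>Y \<in> carrier_mat n n. \<forall>s t. \<epsilon> (s \<cdot>\<^sub>m X + t \<cdot>\<^sub>m Y) = s \<cdot>\<^sub>m \<epsilon> X + t \<cdot>\<^sub>m \<epsilon> Y) \<and>
     (\<forall>X \<in> carrier_mat n n. mtrace (\<epsilon> X) = mtrace X) \<and>
     (\<forall>d X. psd (n*d) X \<longrightarrow> psd (n*d) (chan_mid 1 n d \<epsilon> X))"

definition kraus_rep :: "nat \<Rightarrow> (complex mat \<Rightarrow> complex mat) \<Rightarrow> nat \<Rightarrow> (nat \<Rightarrow> complex mat) \<Rightarrow> bool" where
  "kraus_rep n \<epsilon> m K \<longleftrightarrow> (\<forall>j<m. K j \<in> carrier_mat n n) \<and>
     (\<forall>X \<in> carrier_mat n n. \<epsilon> X = msum n n m (\<lambda>j. K j * X * adj (K j)))"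

definition schmidt_coeffs :: "nat \<Rightarrow> (nat \<Rightarrow> real) \<Rightarrow> bool" where
  "schmidt_coeffs P \<mu> \<longleftrightarrow> (\<forall>i<P. \<mu> i \<ge> 0) \<and> (\<Sum>i<P. (\<mu> i)\<^sup>2) = 1"

text \<open>The state sum_i mu_i |i>|i> as a vector of dimension P*P (index a*P+b).\<close>
definition schmidt_vec :: "nat \<Rightarrow> (nat \<Rightarrow> real) \<Rightarrow> complex vec" where
  "schmidt_vec P \<mu> = vec (P*P) (\<lambda>r. if r div P = r mod P then complex_of_real (\<mu> (r div P)) else 0)"

definition max_ent :: "nat \<Rightarrow> complex vec" where
  "max_ent N = schmidt_vec N (\<lambda>_. 1 / sqrt (real N))"

text \<open>rho^A \<otimes> |psi><psi|^{ab} in the ordering a, A, b.\<close>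
definition init_state :: "nat \<Rightarrow> nat \<Rightarrow> (nat \<Rightarrow> real) \<Rightarrow> complex mat \<Rightarrow> complex mat" where
  "init_state P N \<mu> \<rho> = mat (P*N*P) (P*N*P) (\<lambda>(r,c).
     \<rho> $$ ((r div P) mod N, (c div P) mod N) *
     (if r div (N*P) = r mod P \<and> c div (N*P) = c mod P
      then complex_of_real (\<mu> (r div (N*P)) * \<mu> (c div (N*P))) else 0))"

text \<open>Output of the protocol: LA eta acts on a\<otimes>A (dimension P*N), LB eta on B\<otimes>b (N*P).\<close>
definition protocol_out :: "nat \<Rightarrow> nat \<Rightarrow> (complex mat \<Rightarrow> complex mat) \<Rightarrow> (nat \<Rightarrow> real) \<Rightarrow> nat
     \<Rightarrow> (nat \<Rightarrow> complex mat) \<Rightarrow> (nat \<Rightarrow> complex mat) \<Rightarrow> complex mat \<Rightarrow> complex mat" where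
  "protocol_out N P \<epsilon> \<mu> M LA LB \<rho> = msum N N M (\<lambda>\<eta>.
     ptrace_outer P N P
       (kron (1\<^sub>m P) (LB \<eta>) *
        chan_mid P N P \<epsilon> (kron (LA \<eta>) (1\<^sub>m P) * init_state P N \<mu> \<rho> * adj (kron (LA \<eta>) (1\<^sub>m P))) *
        adj (kron (1\<^sub>m P) (LB \<eta>))))"

definition det_faithful :: "nat \<Rightarrow> nat \<Rightarrow> (complex mat \<Rightarrow> complex mat) \<Rightarrow> (nat \<Rightarrow> real) \<Rightarrow> nat
     \<Rightarrow> (nat \<Rightarrow> complex mat) \<Rightarrow> (nat \<Rightarrow> complex mat) \<Rightarrow> bool" where
  "det_faithful N P \<epsilon> \<mu> M LA LB \<longleftrightarrow>
     (\<forall>\<eta><M. \<exists>Q U. projection_mat (P*N) Q \<and> unitary_mat (P*N) U \<and> LA \<eta> = Q * U) \<and>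
     msum (P*N) (P*N) M (\<lambda>\<eta>. adj (LA \<eta>) * LA \<eta>) = 1\<^sub>m (P*N) \<and>
     msum (P*N) (P*N) M (\<lambda>\<eta>. LA \<eta> * adj (LA \<eta>)) = 1\<^sub>m (P*N) \<and>
     (\<forall>\<eta><M. unitary_mat (N*P) (LB \<eta>)) \<and>
     (\<forall>\<rho>. density N \<rho> \<longrightarrow> protocol_out N P \<epsilon> \<mu> M LA LB \<rho> = \<rho>)"

text \<open>Deterministic conversion of pure bipartite state psi (P x P) into phi (N x N) by
  one-way LOCC: A applies an instrument with Kraus operators K k, sends k, B applies an
  instrument with Kraus operators L k l; every branch yields phi.\<close>
definition locc_convertible :: "nat \<Rightarrow> nat \<Rightarrow> complex vec \<Rightarrow> complex vec \<Rightarrow> bool" where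
  "locc_convertible P N \<psi> \<phi> \<longleftrightarrow> (\<exists>Ma K Mb L.
     (\<forall>k<Ma. K k \<in> carrier_mat N P) \<and>
     msum P P Ma (\<lambda>k. adj (K k) * K k) = 1\<^sub>m P \<and>
     (\<forall>k<Ma. (\<forall>l<Mb k. L k l \<in> carrier_mat N P) \<and>
              msum P P (Mb k) (\<lambda>l. adj (L k l) * L k l) = 1\<^sub>m P) \<and>
     (\<forall>k<Ma. \<forall>l<Mb k. \<exists>c. kron (K k) (L k l) *\<^sub>v \<psi> = c \<cdot>\<^sub>v \<phi>))"

end

theory Submission
  imports Defs "Jordan_Normal_Form.Determinant"
begin

text \<open>
  Sufficiency is teleportation: Alice projects onto a Bell basis and Bob corrects the ancilla b and
  swaps it into the output; the channel acts on a system that is then discarded, so only trace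
  preservation matters.

  For necessity, maximal rank means that the Choi matrix of the channel is positive definite: a
  singular one is eliminated by Schur complements in \<open>N\<^sup>2 - 1\<close> steps, which gives a Kraus
  representation with \<open>N\<^sup>2 - 1\<close> operators. Feeding a pure state \<open>\<phi>\<close> into a faithful
  protocol and testing the output against \<open>\<chi> \<bottom> \<phi>\<close> gives a vanishing sum of values of the
  Choi form; by definiteness every branch, with any matrix unit in place of the channel, has zero
  matrix element between \<open>\<chi>\<close> and \<open>\<phi>\<close> and is therefore a multiple of the identity.
  Hence, writing \<open>T\<^sub>r\<close> for the map from A to b given by row \<open>r\<close> of \<open>L\<^sup>A\<^sup>a\<^sub>\<eta>\<close> applied to
  the shared state, unitarity of Bob's operations makes every \<open>T\<^sub>r\<^sup>\<dagger> T\<^sub>s\<close> a multiple of the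
  identity. So \<open>T\<^sub>r\<close> is \<open>\<surd>c\<^sub>r\<close> times an isometry \<open>W\<^sub>r\<close>, and completeness of Alice's
  operators gives \<open>N diag(\<mu>\<^sup>2) = \<Sum>\<^sub>r c\<^sub>r W\<^sub>r W\<^sub>r\<^sup>\<dagger> \<le> \<Sum>\<^sub>r c\<^sub>r = 1\<close>, that is \<open>\<mu>\<^sub>i\<^sup>2 \<le> 1/N\<close>.
  The rows themselves, reshaped to \<open>N \<times> P\<close> matrices, are Alice's Kraus operators for the
  conversion to a maximally entangled state, and Bob then undoes \<open>W\<^sub>r\<close>.
\<close>

section \<open>Positive semidefinite forms\<close>

text \<open>Matrices and vectors are plain functions on indices, read only below \<open>n\<close>,
  so the Schur steps need no dimension bookkeeping.\<close>

definition qform :: "nat \<Rightarrow> (nat \<Rightarrow> nat \<Rightarrow> complex) \<Rightarrow> (nat \<Rightarrow> complex) \<Rightarrow> complex" where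
  "qform n A v = (\<Sum>i<n. \<Sum>j<n. cnj (v i) * A i j * v j)"

definition psd_form :: "nat \<Rightarrow> (nat \<Rightarrow> nat \<Rightarrow> complex) \<Rightarrow> bool" where
  "psd_form n A \<longleftrightarrow> (\<forall>v. Im (qform n A v) = 0 \<and> Re (qform n A v) \<ge> 0)"

text \<open>Moving one coordinate by \<open>t\<close> makes the form a quadratic polynomial in
  \<open>t\<close>; hermitian symmetry, the kernel property and Schur complements are all read off
  from it.\<close>

lemma qform_add_unit:
  assumes "p < n"
  shows "qform n A (\<lambda>i. v i + (if i = p then t else 0)) =
    qform n A v + cnj t * (\<Sum>j<n. A p j * v j) + t * (\<Sum>i<n. cnj (v i) * A i p) + cnj t * t * A p p"
proof -
  have "qform n A (\<lambda>i. v i + (if i = p then t else 0)) =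
    (\<Sum>i<n. \<Sum>j<n. cnj (v i) * A i j * v j + (if i = p then cnj t * (A p j * v j) else 0)
       + (if j = p then t * (cnj (v i) * A i p) else 0)
       + (if i = p then if j = p then cnj t * t * A p p else 0 else 0))"
    unfolding qform_def by (intro sum.cong refl) (auto simp: algebra_simps)
  also have "\<dots> = (\<Sum>i<n. (\<Sum>j<n. cnj (v i) * A i j * v j) + (if i = p then \<Sum>j<n. cnj t * (A p j * v j) else 0)
       + t * (cnj (v i) * A i p)
       + (if i = p then cnj t * t * A p p else 0))"
    using assms by (intro sum.cong refl) (auto simp: sum.distrib)
  also have "\<dots> = qform n A v + cnj t * (\<Sum>j<n. A p j * v j) + t * (\<Sum>i<n. cnj (v i) * A i p) + cnj t * t * A p p"
    unfolding qform_def using assms by (simp add: sum.distrib sum_distrib_left)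
  finally show ?thesis .
qed

lemma qform_unit: "p < n \<Longrightarrow> qform n A (\<lambda>i. if i = p then t else 0) = cnj t * t * A p p"
  using qform_add_unit[of p n A "\<lambda>_. 0" t] by (simp add: qform_def)

lemma psd_form_diag:
  assumes "psd_form n A" "p < n"
  shows "Im (A p p) = 0" "Re (A p p) \<ge> 0"
  using assms(1)[unfolded psd_form_def, rule_format, of "\<lambda>i. if i = p then 1 else 0"]
  unfolding qform_unit[OF assms(2)] by simp_all

lemma psd_form_hermitian:
  assumes psd: "psd_form n A" and i: "i < n" and j: "j < n"
  shows "A i j = cnj (A j i)"
proof (cases "i = j")
  case True
  then show ?thesis using psd_form_diag(1)[OF psd i] by (simp add: complex_eq_iff)
next
  case False
  have eq: "qform n A (\<lambda>k. (if k = i then 1 else 0) + (if k = j then t else 0)) =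
     A i i + cnj t * A j i + t * A i j + cnj t * t * A j j" for t
  proof -
    have "(\<Sum>k<n. A j k * (if k = i then 1 else 0)) = (\<Sum>k<n. if k = i then A j i else 0)"
      "(\<Sum>k<n. cnj (if k = i then 1 else 0) * A k j) = (\<Sum>k<n. if k = i then A i j else 0)"
      by (rule sum.cong, simp, simp)+
    then show ?thesis
      unfolding qform_add_unit[OF j] using i qform_unit[OF i, of A 1] by simp
  qed
  have im: "Im (A i i + cnj t * A j i + t * A i j + cnj t * t * A j j) = 0" for t
    unfolding eq[symmetric] using psd unfolding psd_form_def by blast
  \<comment> \<open>Reality at \<open>t = 1\<close> gives opposite imaginary parts, reality at
    \<open>t = \<i>\<close> gives equal real parts.\<close>
  show ?thesis
    using im[of 1] im[of \<i>] psd_form_diag(1)[OF psd i] psd_form_diag(1)[OF psd j]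
    by (simp add: complex_eq_iff)
qed

lemma psd_form_cnj_row:
  assumes "psd_form n A" "p < n"
  shows "(\<Sum>i<n. cnj (v i) * A i p) = cnj (\<Sum>j<n. A p j * v j)"
  using assms by (auto intro!: sum.cong simp: cnj_sum psd_form_hermitian[OF assms(1), of _ p])

text \<open>A zero of a nonnegative form is a minimum, so the gradient vanishes there; a nonzero
  component \<open>z\<close> would allow a step down to a negative value.\<close>

lemma psd_form_kernel:
  assumes psd: "psd_form n A" and zero: "qform n A v = 0" and p: "p < n"
  shows "(\<Sum>j<n. A p j * v j) = 0"
proof (rule ccontr)
  define z where "z = (\<Sum>j<n. A p j * v j)"
  define a where "a = Re (A p p)"
  assume "\<not> ?thesis"
  then have z: "z \<noteq> 0" by (simp add: z_def)
  have a: "A p p = of_real a" "a \<ge> 0"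
    using psd_form_diag[OF psd p] by (auto simp: a_def complex_eq_iff)
  \<comment> \<open>Any \<open>e > 0\<close> with \<open>e * a < 2\<close> makes the step
    \<open>- e * z\<close> lower the form; this choice also covers \<open>a = 0\<close>.\<close>
  define e where "e = 1 / (a + 1)"
  have "qform n A (\<lambda>i. v i + (if i = p then - of_real e * z else 0)) =
     of_real ((cmod z)\<^sup>2 * (e * (e * a - 2)))"
    unfolding qform_add_unit[OF p] psd_form_cnj_row[OF psd p] zero z_def[symmetric] a
    using complex_norm_square[of z] by (simp add: algebra_simps)
  moreover have "(cmod z)\<^sup>2 * (e * (e * a - 2)) < 0"
  proof -
    have "e > 0" "e * a < 2" using a(2) by (auto simp: e_def field_simps)
    then have "e * (e * a - 2) < 0" by (simp add: mult_pos_neg)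
    then show ?thesis using z by (simp add: mult_pos_neg)
  qed
  ultimately show False using psd unfolding psd_form_def
    by (metis Re_complex_of_real not_less)
qed

text \<open>The complement at \<open>v\<close> is the value of the original form after coordinate
  \<open>p\<close> of \<open>v\<close> has been moved to its minimizer.\<close>

lemma psd_form_schur_complement:
  assumes psd: "psd_form n A" and p: "p < n" and nz: "A p p \<noteq> 0"
  shows "psd_form n (\<lambda>i j. A i j - A i p * A p j / A p p)"
proof -
  have "qform n (\<lambda>i j. A i j - A i p * A p j / A p p) v =
     qform n A (\<lambda>i. v i + (if i = p then - (\<Sum>j<n. A p j * v j) / A p p else 0))" for v
  proof -
    define z where "z = (\<Sum>j<n. A p j * v j)"
    have "qform n (\<lambda>i j. A i j - A i p * A p j / A p p) v =
      qform n A v - (\<Sum>i<n. \<Sum>j<n. (cnj (v i) * A i p) * (A p j * v j)) / A p p"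
      unfolding qform_def
      by (simp add: algebra_simps sum_subtractf sum_divide_distrib)
    also have "(\<Sum>i<n. \<Sum>j<n. (cnj (v i) * A i p) * (A p j * v j)) = cnj z * z"
      unfolding sum_product[symmetric] psd_form_cnj_row[OF psd p] z_def ..
    finally have 1: "qform n (\<lambda>i j. A i j - A i p * A p j / A p p) v = qform n A v - cnj z * z / A p p" .
    have "cnj (A p p) = A p p" using psd_form_hermitian[OF psd p p] by simp
    then show ?thesis
      unfolding 1 qform_add_unit[OF p] psd_form_cnj_row[OF psd p] z_def[symmetric]
      using nz by (simp add: field_simps)
  qed
  then show ?thesis using psd unfolding psd_form_def by simp
qed

text \<open>
  Each index of \<open>S\<close> serves as a pivot once and costs one rank-one term. The index \<open>k\<close> needs no
  pivot: Schur complements keep \<open>v\<close> in the kernel, so the last remaining entry \<open>A k k\<close> vanishes.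
\<close>

lemma psd_form_decomp_aux:
  assumes "finite S" "S \<subseteq> {..<n}" "k < n" "v k \<noteq> 0"
    and "psd_form n A" "\<And>i. i < n \<Longrightarrow> (\<Sum>j<n. A i j * v j) = 0"
    and "\<And>i j. i < n \<Longrightarrow> j < n \<Longrightarrow> i \<notin> insert k S \<Longrightarrow> A i j = 0"
  shows "\<exists>w. \<forall>i<n. \<forall>j<n. A i j = (\<Sum>t<card S. w t i * cnj (w t j))"
  using assms
proof (induction S arbitrary: A rule: finite_induct)
  case empty
  have off: "A i j = 0" if "i < n" "j < n" "i \<noteq> k \<or> j \<noteq> k" for i j
    using that empty.prems(6)[of i j] empty.prems(6)[of j i] psd_form_hermitian[OF empty.prems(4), of i j]
    by auto
  have "(\<Sum>j<n. A k j * v j) = (\<Sum>j<n. if j = k then A k k * v k else 0)"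
    using off[OF empty.prems(2)] by (intro sum.cong) auto
  then have "A k k = 0"
    using empty.prems by simp
  then show ?case using off by (metis card.empty lessThan_0 sum.empty)
next
  case (insert p S)
  note psd = insert.prems(4) and ker = insert.prems(5) and supp = insert.prems(6)
  have p: "p < n" using insert.prems by auto
  show ?case
  proof (cases "A p p = 0")
    case True
    \<comment> \<open>The unit vector at \<open>p\<close> is a zero of the form, so the kernel
      property clears column \<open>p\<close>; a zero term then fills the slot of
      \<open>p\<close>.\<close>
    have col: "A i p = 0" if "i < n" for i
      using psd_form_kernel[OF psd _ that, of "\<lambda>i. if i = p then 1 else 0"] qform_unit[OF p, of A 1] True p
      by (simp add: if_distrib cong: if_cong)
    have row: "A p j = 0" if "j < n" for j
      using col[OF that] psd_form_hermitian[OF psd p that] by simp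
    obtain w where w: "\<forall>i<n. \<forall>j<n. A i j = (\<Sum>t<card S. w t i * cnj (w t j))"
      using insert.IH[OF _ insert.prems(2,3) psd ker] insert.prems(1) supp row by blast
    show ?thesis
      using insert.hyps w by (intro exI[of _ "w(card S := \<lambda>_. 0)"]) simp
  next
    case nz: False
    define B where "B = (\<lambda>i j. A i j - A i p * A p j / A p p)"
    define a where "a = Re (A p p)"
    have a: "A p p = of_real a" "a > 0"
      using psd_form_diag[OF psd p] nz by (auto simp: a_def complex_eq_iff)
    have "psd_form n B"
      unfolding B_def by (rule psd_form_schur_complement[OF psd p nz])
    moreover have "(\<Sum>j<n. B i j * v j) = 0" if "i < n" for i
    proof -
      have "(\<Sum>j<n. B i j * v j) = (\<Sum>j<n. A i j * v j) - A i p / A p p * (\<Sum>j<n. A p j * v j)"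
        unfolding B_def by (simp add: algebra_simps sum_subtractf sum_distrib_left)
      then show ?thesis using ker that p by simp
    qed
    moreover have "B i j = 0" if "i < n" "j < n" "i \<notin> insert k S" for i j
      using that supp[of i j] supp[of i p] p nz by (cases "i = p") (auto simp: B_def)
    ultimately obtain w where w: "\<forall>i<n. \<forall>j<n. B i j = (\<Sum>t<card S. w t i * cnj (w t j))"
      using insert.IH[OF _ insert.prems(2,3), of B] insert.prems(1) by blast
    have "A i j = B i j + (A i p / of_real (sqrt a)) * cnj (A j p / of_real (sqrt a))"
      if "i < n" "j < n" for i j
    proof -
      have "complex_of_real (sqrt a) * complex_of_real (sqrt a) = of_real a"
        using a(2) by (simp flip: of_real_mult)
      then show ?thesis
        using psd_form_hermitian[OF psd p that(2)] a by (simp add: B_def)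
    qed
    then show ?thesis
      using insert.hyps w
      by (intro exI[of _ "w(card S := \<lambda>i. A i p / of_real (sqrt a))"]) simp
  qed
qed

text \<open>Any index where the null vector is nonzero can be the one spared as a pivot, which saves
  one term.\<close>

lemma psd_form_decomp_singular:
  assumes psd: "psd_form n A" and zero: "qform n A v = 0" and k: "k < n" "v k \<noteq> 0"
  obtains w where "\<And>i j. i < n \<Longrightarrow> j < n \<Longrightarrow> A i j = (\<Sum>t<n - 1. w t i * cnj (w t j))"
proof -
  have "\<exists>w. \<forall>i<n. \<forall>j<n. A i j = (\<Sum>t<card ({..<n} - {k}). w t i * cnj (w t j))"
    by (rule psd_form_decomp_aux[where k = k and v = v])
      (use assms psd_form_kernel[OF psd zero] in auto)
  then show thesis using k(1) that by auto
qed

section \<open>The Choi matrix\<close>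

lemma pair_index_less: "a < p \<Longrightarrow> b < q \<Longrightarrow> a * q + b < p * (q::nat)"
  using mult_le_mono1[of "Suc a" p q] by simp

lemma pair_index_eq_iff:
  fixes a b c d q :: nat
  assumes "b < q" "d < q"
  shows "a * q + b = c * q + d \<longleftrightarrow> a = c \<and> b = d"
proof
  assume eq: "a * q + b = c * q + d"
  have "a = (a * q + b) div q" "c = (c * q + d) div q"
    using assms by simp_all
  then have "a = c" using eq by metis
  then show "a = c \<and> b = d" using eq by simp
qed simp

lemma sum_lessThan_prod:
  fixes f :: "nat \<Rightarrow> 'a::comm_monoid_add"
  shows "(\<Sum>r<p * q. f r) = (\<Sum>a<p. \<Sum>b<q. f (a * q + b))"
proof -
  have "sum f {a * q..<a * q + q} = (\<Sum>b<q. f (a * q + b))" for a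
    using sum.shift_bounds_nat_ivl[of f 0 "a * q" q] by (simp add: lessThan_atLeast0 add.commute)
  then show ?thesis unfolding sum.nat_group[symmetric] by simp
qed

lemma adj_dim [simp]: "dim_row (adj A) = dim_col A" "dim_col (adj A) = dim_row A"
  by (simp_all add: adj_def)

lemma adj_carrier [simp]: "adj A \<in> carrier_mat m n \<longleftrightarrow> A \<in> carrier_mat n m"
  unfolding carrier_mat_def mem_Collect_eq adj_dim by (rule conj_commute)

lemma adj_entry: "A \<in> carrier_mat n m \<Longrightarrow> i < m \<Longrightarrow> j < n \<Longrightarrow> adj A $$ (i, j) = cnj (A $$ (j, i))"
  by (auto simp: adj_def)

lemma mult_entry:
  assumes "A \<in> carrier_mat n m" "B \<in> carrier_mat m l" "i < n" "j < l"
  shows "((A :: complex mat) * B) $$ (i, j) = (\<Sum>k<m. A $$ (i, k) * B $$ (k, j))"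
proof -
  have "(A * B) $$ (i, j) = (\<Sum>k = 0..<m. row A i $ k * col B j $ k)"
    using assms by (simp add: scalar_prod_def)
  also have "\<dots> = (\<Sum>k<m. A $$ (i, k) * B $$ (k, j))"
    using assms unfolding lessThan_atLeast0 by (intro sum.cong refl) simp
  finally show ?thesis .
qed

lemma conj_entry:
  assumes "A \<in> carrier_mat n m" "X \<in> carrier_mat m m" "i < n" "j < n"
  shows "(A * X * adj A) $$ (i, j) = (\<Sum>k<m. \<Sum>l<m. A $$ (i, k) * X $$ (k, l) * cnj (A $$ (j, l)))"
proof -
  have "(A * X * adj A) $$ (i, j) = (\<Sum>l<m. (A * X) $$ (i, l) * adj A $$ (l, j))"
    using assms by (intro mult_entry) auto
  also have "\<dots> = (\<Sum>l<m. \<Sum>k<m. A $$ (i, k) * X $$ (k, l) * cnj (A $$ (j, l)))"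
    using assms by (intro sum.cong refl) (simp add: mult_entry adj_entry sum_distrib_right del: index_mult_mat)
  finally show ?thesis by (subst sum.swap)
qed

definition matrix_unit :: "nat \<Rightarrow> nat \<Rightarrow> nat \<Rightarrow> complex mat" where
  "matrix_unit n k l = mat n n (\<lambda>(i, j). if i = k \<and> j = l then 1 else 0)"

text \<open>Index \<open>i * n + k\<close> pairs output \<open>i\<close> with input
  \<open>k\<close>, so a vector indexed this way reshapes directly into an \<open>n\<close> by
  \<open>n\<close> Kraus operator.\<close>

definition choi :: "nat \<Rightarrow> (complex mat \<Rightarrow> complex mat) \<Rightarrow> nat \<Rightarrow> nat \<Rightarrow> complex" where
  "choi n \<epsilon> r c = \<epsilon> (matrix_unit n (r mod n) (c mod n)) $$ (r div n, c div n)"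

lemma matrix_unit_carrier [simp]: "matrix_unit n k l \<in> carrier_mat n n"
  by (simp add: matrix_unit_def)

lemma cptp_carrier:
  assumes "cptp n \<epsilon>" "X \<in> carrier_mat n n"
  shows "\<epsilon> X \<in> carrier_mat n n"
  using assms(1)[unfolded cptp_def, THEN conjunct1, rule_format, OF assms(2)] .

lemma cptp_linear:
  assumes "cptp n \<epsilon>" "X \<in> carrier_mat n n" "Y \<in> carrier_mat n n"
  shows "\<epsilon> (s \<cdot>\<^sub>m X + t \<cdot>\<^sub>m Y) = s \<cdot>\<^sub>m \<epsilon> X + t \<cdot>\<^sub>m \<epsilon> Y"
  using assms(1)[unfolded cptp_def, THEN conjunct2, THEN conjunct1, rule_format, OF assms(2,3)] .

lemma cptp_trace:
  assumes "cptp n \<epsilon>" "X \<in> carrier_mat n n"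
  shows "mtrace (\<epsilon> X) = mtrace X"
  using assms(1)[unfolded cptp_def, THEN conjunct2, THEN conjunct2, THEN conjunct1, rule_format, OF assms(2)] .

text \<open>\<open>cptp\<close> speaks of two-term combinations only; growing the support by one
  matrix unit at a time gives the full expansion.\<close>

lemma cptp_expand_on:
  assumes eps: "cptp n \<epsilon>" and ij: "i < n" "j < n"
    and S: "finite S" "S \<subseteq> {..<n} \<times> {..<n}"
  shows "\<epsilon> (mat n n (\<lambda>p. if p \<in> S then X p else 0)) $$ (i, j) =
    (\<Sum>(k, l)\<in>S. X (k, l) * \<epsilon> (matrix_unit n k l) $$ (i, j))"
  using S
proof (induction S rule: finite_induct)
  case empty
  let ?Z = "0\<^sub>m n n :: complex mat"
  have "\<epsilon> (0 \<cdot>\<^sub>m ?Z + 0 \<cdot>\<^sub>m ?Z) = 0 \<cdot>\<^sub>m \<epsilon> ?Z + 0 \<cdot>\<^sub>m \<epsilon> ?Z"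
    by (rule cptp_linear[OF eps]) auto
  moreover have "0 \<cdot>\<^sub>m ?Z + 0 \<cdot>\<^sub>m ?Z = mat n n (\<lambda>p. if p \<in> {} then X p else 0)"
    by (intro eq_matI) auto
  ultimately have "\<epsilon> (mat n n (\<lambda>p. if p \<in> {} then X p else 0)) = 0 \<cdot>\<^sub>m \<epsilon> ?Z + 0 \<cdot>\<^sub>m \<epsilon> ?Z"
    by (simp only:)
  then show ?case
    using cptp_carrier[OF eps, of ?Z] ij by (simp del: if_False empty_iff)
next
  case (insert q S)
  obtain k l where q: "q = (k, l)" by (cases q)
  let ?Y = "mat n n (\<lambda>p. if p \<in> S then X p else 0)"
  have "mat n n (\<lambda>p. if p \<in> insert q S then X p else 0) = 1 \<cdot>\<^sub>m ?Y + X q \<cdot>\<^sub>m matrix_unit n k l"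
    using insert.hyps q by (intro eq_matI) (auto simp: matrix_unit_def)
  then have "\<epsilon> (mat n n (\<lambda>p. if p \<in> insert q S then X p else 0)) = 1 \<cdot>\<^sub>m \<epsilon> ?Y + X q \<cdot>\<^sub>m \<epsilon> (matrix_unit n k l)"
    using cptp_linear[OF eps, of ?Y "matrix_unit n k l" 1 "X q"] by simp
  then show ?case
    using insert cptp_carrier[OF eps, of ?Y] cptp_carrier[OF eps, of "matrix_unit n k l"] ij q
    by (simp add: add.commute)
qed

lemma cptp_entry:
  assumes eps: "cptp n \<epsilon>" and X: "X \<in> carrier_mat n n" and ij: "i < n" "j < n"
  shows "\<epsilon> X $$ (i, j) = (\<Sum>k<n. \<Sum>l<n. X $$ (k, l) * choi n \<epsilon> (i * n + k) (j * n + l))"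
proof -
  have "X = mat n n (\<lambda>p. if p \<in> {..<n} \<times> {..<n} then X $$ p else 0)"
    using X by (intro eq_matI) auto
  then have "\<epsilon> X $$ (i, j) = (\<Sum>(k, l)\<in>{..<n} \<times> {..<n}. X $$ (k, l) * \<epsilon> (matrix_unit n k l) $$ (i, j))"
    using cptp_expand_on[OF eps ij, of "{..<n} \<times> {..<n}" "\<lambda>p. X $$ p"] by simp
  also have "\<dots> = (\<Sum>(k, l)\<in>{..<n} \<times> {..<n}. X $$ (k, l) * choi n \<epsilon> (i * n + k) (j * n + l))"
    by (intro sum.cong refl) (auto simp: choi_def)
  finally show ?thesis by (simp add: sum.cartesian_product)
qed

lemma psd_iff_psd_form:
  "psd n A \<longleftrightarrow> A \<in> carrier_mat n n \<and> psd_form n (\<lambda>i j. A $$ (i, j))"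
proof -
  let ?P = "\<lambda>v. Im (qform n (\<lambda>i j. A $$ (i, j)) v) = 0 \<and> Re (qform n (\<lambda>i j. A $$ (i, j)) v) \<ge> 0"
  have "psd n A \<longleftrightarrow> A \<in> carrier_mat n n \<and> (\<forall>v\<in>carrier_vec n. ?P (($) v))"
    unfolding psd_def qform_def Let_def ..
  moreover have "?P v \<longleftrightarrow> ?P (($) (vec n v))" for v
    unfolding qform_def by simp
  ultimately show ?thesis
    unfolding psd_form_def using vec_carrier by blast
qed

lemma qform_rank_one: "qform n (\<lambda>i j. u i * cnj (u j)) v = complex_of_real ((cmod (\<Sum>j<n. cnj (u j) * v j))\<^sup>2)"
proof -
  have "qform n (\<lambda>i j. u i * cnj (u j)) v = (\<Sum>i<n. \<Sum>j<n. (cnj (v i) * u i) * (cnj (u j) * v j))"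
    unfolding qform_def by (simp add: mult_ac)
  also have "\<dots> = cnj (\<Sum>j<n. cnj (u j) * v j) * (\<Sum>j<n. cnj (u j) * v j)"
    unfolding sum_product[symmetric] by (simp add: cnj_sum mult_ac)
  finally show ?thesis unfolding complex_norm_square by (simp only: mult.commute)
qed

lemma psd_form_rank_one: "psd_form n (\<lambda>i j. u i * cnj (u j))"
  unfolding psd_form_def qform_rank_one by simp

text \<open>Complete positivity is applied, with an ancilla of dimension \<open>n\<close>, to the
  unnormalised maximally entangled projector \<open>X\<close>, whose image is the Choi
  matrix.\<close>

lemma psd_form_choi:
  assumes eps: "cptp n \<epsilon>"
  shows "psd_form (n * n) (choi n \<epsilon>)"
proof -
  define u where "u r = (if r div n = r mod n then 1 else 0 :: complex)" for r
  define X where "X = mat (n * n) (n * n) (\<lambda>(r, c). u r * cnj (u c))"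
  have "psd_form (n * n) (\<lambda>i j. X $$ (i, j))"
  proof -
    have "qform (n * n) (\<lambda>i j. X $$ (i, j)) v = qform (n * n) (\<lambda>i j. u i * cnj (u j)) v" for v
      unfolding qform_def X_def by (intro sum.cong) auto
    then show ?thesis using psd_form_rank_one unfolding psd_form_def by simp
  qed
  then have "psd (n * n) X" unfolding psd_iff_psd_form X_def by simp
  then have psd: "psd_form (n * n) (\<lambda>i j. chan_mid 1 n n \<epsilon> X $$ (i, j))"
    using eps unfolding cptp_def psd_iff_psd_form by blast
  have "chan_mid 1 n n \<epsilon> X $$ (r, c) = choi n \<epsilon> r c" if rc: "r < n * n" "c < n * n" for r c
  proof -
    have n: "n > 0" using rc by (cases n) auto
    have "mat n n (\<lambda>(i, j). X $$ (((r div (n * n)) * n + i) * n + r mod n, ((c div (n * n)) * n + j) * n + c mod n))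
       = matrix_unit n (r mod n) (c mod n)"
      using rc n by (intro eq_matI) (auto simp: matrix_unit_def X_def u_def pair_index_less)
    moreover have "r div n < n" "c div n < n"
      using rc by (simp_all add: less_mult_imp_div_less)
    ultimately show ?thesis using rc by (simp add: chan_mid_def choi_def)
  qed
  then have "qform (n * n) (\<lambda>i j. chan_mid 1 n n \<epsilon> X $$ (i, j)) v = qform (n * n) (choi n \<epsilon>) v" for v
    unfolding qform_def by (intro sum.cong) auto
  then show ?thesis using psd unfolding psd_form_def by simp
qed

text \<open>A null vector with a nonzero entry would make the Choi matrix singular; the rank-one
  terms of its decomposition then reshape into too few Kraus operators.\<close>

lemma choi_definite:
  assumes eps: "cptp n \<epsilon>" and rank: "\<forall>m K. kraus_rep n \<epsilon> m K \<longrightarrow> n\<^sup>2 \<le> m"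
    and zero: "qform (n * n) (choi n \<epsilon>) v = 0" and k: "k < n * n"
  shows "v k = 0"
proof (rule ccontr)
  assume "v k \<noteq> 0"
  then obtain w where w: "\<And>i j. i < n * n \<Longrightarrow> j < n * n \<Longrightarrow>
      choi n \<epsilon> i j = (\<Sum>t<n * n - 1. w t i * cnj (w t j))"
    using psd_form_decomp_singular[OF psd_form_choi[OF eps] zero k] by blast
  define K where "K t = mat n n (\<lambda>(i, k). w t (i * n + k))" for t
  have K: "K t \<in> carrier_mat n n" for t by (simp add: K_def)
  have "\<epsilon> X = msum n n (n * n - 1) (\<lambda>t. K t * X * adj (K t))" if X: "X \<in> carrier_mat n n" for X
  proof (rule eq_matI)
    fix i j assume "i < dim_row (msum n n (n * n - 1) (\<lambda>t. K t * X * adj (K t)))"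
      and "j < dim_col (msum n n (n * n - 1) (\<lambda>t. K t * X * adj (K t)))"
    then have ij: "i < n" "j < n" by (simp_all add: msum_def)
    have "\<epsilon> X $$ (i, j) = (\<Sum>k<n. \<Sum>l<n. \<Sum>t<n * n - 1. K t $$ (i, k) * X $$ (k, l) * cnj (K t $$ (j, l)))"
      unfolding cptp_entry[OF eps X ij] using ij
      by (intro sum.cong refl) (simp add: w pair_index_less K_def sum_distrib_left mult_ac)
    also have "\<dots> = (\<Sum>t<n * n - 1. \<Sum>k<n. \<Sum>l<n. K t $$ (i, k) * X $$ (k, l) * cnj (K t $$ (j, l)))"
      by (simp only: sum.swap[of _ "{..<n * n - 1}"])
    also have "\<dots> = (\<Sum>t<n * n - 1. (K t * X * adj (K t)) $$ (i, j))"
      by (simp only: conj_entry[OF K X ij])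
    finally show "\<epsilon> X $$ (i, j) = msum n n (n * n - 1) (\<lambda>t. K t * X * adj (K t)) $$ (i, j)"
      using ij by (simp add: msum_def)
  qed (use cptp_carrier[OF eps X] in \<open>auto simp: msum_def\<close>)
  then have "kraus_rep n \<epsilon> (n * n - 1) K"
    unfolding kraus_rep_def using K by blast
  then have "n\<^sup>2 \<le> n * n - 1" using rank by blast
  \<comment> \<open>\<open>k < n * n\<close> makes \<open>n * n\<close> positive, so the truncated
    difference is strictly smaller.\<close>
  then show False using k by (simp add: power2_eq_square)
qed

section \<open>Entries of the protocol output\<close>

lemma sum_lessThan_single:
  fixes f :: "nat \<Rightarrow> 'a::comm_monoid_add"
  assumes "a < p" "\<And>c. c < p \<Longrightarrow> c \<noteq> a \<Longrightarrow> f c = 0"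
  shows "(\<Sum>c<p. f c) = f a"
  using assms sum.mono_neutral_right[of "{..<p}" "{a}" f] by auto

lemma triple_index_div: "i < n \<Longrightarrow> b < q \<Longrightarrow> ((a * n + i) * q + b) div (n * q) = (a::nat)"
  by (simp add: div_mult2_eq mult.commute[of n q])

lemma kron_carrier: "A \<in> carrier_mat n m \<Longrightarrow> B \<in> carrier_mat k l \<Longrightarrow> kron A B \<in> carrier_mat (n * k) (m * l)"
  by (simp add: kron_def)

lemma kron_entry:
  assumes "A \<in> carrier_mat n m" "B \<in> carrier_mat k l" "i < n" "j < m" "u < k" "v < l"
  shows "kron A B $$ (i * k + u, j * l + v) = A $$ (i, j) * B $$ (u, v)"
  using assms by (simp add: kron_def pair_index_less)

lemma kron_one_left_conj_entry:
  assumes B: "B \<in> carrier_mat m m" and Z: "Z \<in> carrier_mat (p * m) (p * m)"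
    and ix: "a < p" "a' < p" "u < m" "u' < m"
  shows "(kron (1\<^sub>m p) B * Z * adj (kron (1\<^sub>m p) B)) $$ (a * m + u, a' * m + u') =
    (\<Sum>v<m. \<Sum>w<m. B $$ (u, v) * Z $$ (a * m + v, a' * m + w) * cnj (B $$ (u', w)))"
proof -
  let ?K = "kron (1\<^sub>m p) B"
  have K: "?K \<in> carrier_mat (p * m) (p * m)" using kron_carrier[OF one_carrier_mat B] by simp
  have e: "?K $$ (a * m + u, c * m + v) = (if c = a then B $$ (u, v) else 0)"
    if "a < p" "c < p" "u < m" "v < m" for a c u v
    using kron_entry[OF one_carrier_mat B that] that by simp
  have "(?K * Z * adj ?K) $$ (a * m + u, a' * m + u') =
    (\<Sum>c<p. \<Sum>v<m. \<Sum>d<p. \<Sum>w<m. ?K $$ (a * m + u, c * m + v) * Z $$ (c * m + v, d * m + w)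
       * cnj (?K $$ (a' * m + u', d * m + w)))"
    using ix by (subst conj_entry[OF K Z]) (simp_all add: sum_lessThan_prod pair_index_less)
  also have "\<dots> = (\<Sum>v<m. \<Sum>d<p. \<Sum>w<m. ?K $$ (a * m + u, a * m + v) * Z $$ (a * m + v, d * m + w)
       * cnj (?K $$ (a' * m + u', d * m + w)))"
    using ix by (intro sum_lessThan_single) (simp_all add: e)
  also have "\<dots> = (\<Sum>v<m. \<Sum>w<m. ?K $$ (a * m + u, a * m + v) * Z $$ (a * m + v, a' * m + w)
       * cnj (?K $$ (a' * m + u', a' * m + w)))"
    using ix by (intro sum.cong[OF refl] sum_lessThan_single) (simp_all add: e)
  also have "\<dots> = (\<Sum>v<m. \<Sum>w<m. B $$ (u, v) * Z $$ (a * m + v, a' * m + w) * cnj (B $$ (u', w)))"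
    using ix by (intro sum.cong refl) (simp add: e)
  finally show ?thesis .
qed

lemma kron_one_right_conj_entry:
  assumes L: "L \<in> carrier_mat m m" and X: "X \<in> carrier_mat (m * q) (m * q)"
    and ix: "r < m" "r' < m" "b < q" "b' < q"
  shows "(kron L (1\<^sub>m q) * X * adj (kron L (1\<^sub>m q))) $$ (r * q + b, r' * q + b') =
    (\<Sum>g<m. \<Sum>h<m. L $$ (r, g) * X $$ (g * q + b, h * q + b') * cnj (L $$ (r', h)))"
proof -
  let ?K = "kron L (1\<^sub>m q)"
  have K: "?K \<in> carrier_mat (m * q) (m * q)" using kron_carrier[OF L one_carrier_mat] by simp
  have e: "?K $$ (r * q + b, g * q + d) = (if d = b then L $$ (r, g) else 0)"
    if "r < m" "g < m" "b < q" "d < q" for r g b d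
    using kron_entry[OF L one_carrier_mat that] that by simp
  have "(?K * X * adj ?K) $$ (r * q + b, r' * q + b') =
    (\<Sum>g<m. \<Sum>c<q. \<Sum>h<m. \<Sum>d<q. ?K $$ (r * q + b, g * q + c) * X $$ (g * q + c, h * q + d)
       * cnj (?K $$ (r' * q + b', h * q + d)))"
    using ix by (subst conj_entry[OF K X]) (simp_all add: sum_lessThan_prod pair_index_less)
  also have "\<dots> = (\<Sum>g<m. \<Sum>h<m. \<Sum>d<q. ?K $$ (r * q + b, g * q + b) * X $$ (g * q + b, h * q + d)
       * cnj (?K $$ (r' * q + b', h * q + d)))"
    using ix by (intro sum.cong[OF refl] sum_lessThan_single) (simp_all add: e)
  also have "\<dots> = (\<Sum>g<m. \<Sum>h<m. ?K $$ (r * q + b, g * q + b) * X $$ (g * q + b, h * q + b')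
       * cnj (?K $$ (r' * q + b', h * q + b')))"
    using ix by (intro sum.cong[OF refl] sum_lessThan_single) (simp_all add: e)
  also have "\<dots> = (\<Sum>g<m. \<Sum>h<m. L $$ (r, g) * X $$ (g * q + b, h * q + b') * cnj (L $$ (r', h)))"
    using ix by (intro sum.cong refl) (simp add: e)
  finally show ?thesis .
qed

lemma chan_mid_entry:
  assumes "a < p" "a' < p" "s < n" "s' < n" "b < q" "b' < q"
  shows "chan_mid p n q \<epsilon> X $$ ((a * n + s) * q + b, (a' * n + s') * q + b') =
    \<epsilon> (mat n n (\<lambda>(i, j). X $$ ((a * n + i) * q + b, (a' * n + j) * q + b'))) $$ (s, s')"
  using assms by (simp add: chan_mid_def pair_index_less triple_index_div)

lemma init_state_entry:
  assumes "a < P" "a' < P" "i < N" "i' < N" "b < P" "b' < P"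
  shows "init_state P N \<mu> \<rho> $$ ((a * N + i) * P + b, (a' * N + i') * P + b') =
    \<rho> $$ (i, i') * (if a = b \<and> a' = b' then complex_of_real (\<mu> a * \<mu> a') else 0)"
  using assms by (simp add: init_state_def pair_index_less triple_index_div)

text \<open>Tracing out a forces the same final \<open>a\<close> on both sides, while the Schmidt
  form equates Alice's initial ancilla indices with Bob's \<open>b\<close> and
  \<open>b'\<close>.\<close>

definition channel_input :: "nat \<Rightarrow> (nat \<Rightarrow> real) \<Rightarrow> complex mat \<Rightarrow> complex mat \<Rightarrow> nat \<Rightarrow> nat \<Rightarrow> nat \<Rightarrow> complex mat" where
  "channel_input N \<mu> L \<rho> a b b' = mat N N (\<lambda>(k, l). \<Sum>i<N. \<Sum>j<N.
     L $$ (a * N + k, b * N + i) * \<mu> b * \<rho> $$ (i, j) * (\<mu> b' * cnj (L $$ (a * N + l, b' * N + j))))"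

lemma channel_input_carrier [simp]: "channel_input N \<mu> L \<rho> a b b' \<in> carrier_mat N N"
  by (simp add: channel_input_def)

lemma chan_mid_channel_input:
  assumes L: "L \<in> carrier_mat (P * N) (P * N)"
    and ix: "a < P" "s < N" "s' < N" "b < P" "b' < P"
  shows "chan_mid P N P \<epsilon> (kron L (1\<^sub>m P) * init_state P N \<mu> \<rho> * adj (kron L (1\<^sub>m P)))
      $$ ((a * N + s) * P + b, (a * N + s') * P + b') = \<epsilon> (channel_input N \<mu> L \<rho> a b b') $$ (s, s')"
proof -
  have X: "init_state P N \<mu> \<rho> \<in> carrier_mat (P * N * P) (P * N * P)" by (simp add: init_state_def)
  have "(kron L (1\<^sub>m P) * init_state P N \<mu> \<rho> * adj (kron L (1\<^sub>m P))) $$ ((a * N + k) * P + b, (a * N + l) * P + b')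
     = (\<Sum>i<N. \<Sum>j<N. L $$ (a * N + k, b * N + i) * \<mu> b * \<rho> $$ (i, j) * (\<mu> b' * cnj (L $$ (a * N + l, b' * N + j))))"
    (is "?l = ?r") if kl: "k < N" "l < N" for k l
  proof -
    have "?l = (\<Sum>c<P. \<Sum>i<N. \<Sum>d<P. \<Sum>j<N. L $$ (a * N + k, c * N + i) *
        init_state P N \<mu> \<rho> $$ ((c * N + i) * P + b, (d * N + j) * P + b') * cnj (L $$ (a * N + l, d * N + j)))"
      using ix kl by (subst kron_one_right_conj_entry[OF L X]) (simp_all add: sum_lessThan_prod pair_index_less)
    also have "\<dots> = (\<Sum>i<N. \<Sum>d<P. \<Sum>j<N. L $$ (a * N + k, b * N + i) *
        init_state P N \<mu> \<rho> $$ ((b * N + i) * P + b, (d * N + j) * P + b') * cnj (L $$ (a * N + l, d * N + j)))"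
      using ix by (intro sum_lessThan_single) (simp_all add: init_state_entry)
    also have "\<dots> = (\<Sum>i<N. \<Sum>j<N. L $$ (a * N + k, b * N + i) *
        init_state P N \<mu> \<rho> $$ ((b * N + i) * P + b, (b' * N + j) * P + b') * cnj (L $$ (a * N + l, b' * N + j)))"
      using ix by (intro sum.cong[OF refl] sum_lessThan_single) (simp_all add: init_state_entry)
    also have "\<dots> = ?r"
      using ix by (intro sum.cong refl, subst init_state_entry) (simp_all add: mult_ac)
    finally show ?thesis .
  qed
  then have "mat N N (\<lambda>(k, l). (kron L (1\<^sub>m P) * init_state P N \<mu> \<rho> * adj (kron L (1\<^sub>m P)))
      $$ ((a * N + k) * P + b, (a * N + l) * P + b')) = channel_input N \<mu> L \<rho> a b b'"
    unfolding channel_input_def by (intro cong_mat) auto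
  then show ?thesis
    using chan_mid_entry[OF ix(1,1-5), of \<epsilon> "kron L (1\<^sub>m P) * init_state P N \<mu> \<rho> * adj (kron L (1\<^sub>m P))"]
    by simp
qed

lemma protocol_out_entry:
  assumes LA: "\<And>\<eta>. \<eta> < M \<Longrightarrow> LA \<eta> \<in> carrier_mat (P * N) (P * N)"
    and LB: "\<And>\<eta>. \<eta> < M \<Longrightarrow> LB \<eta> \<in> carrier_mat (N * P) (N * P)"
    and ij: "i < N" "j < N"
  shows "protocol_out N P \<epsilon> \<mu> M LA LB \<rho> $$ (i, j) = (\<Sum>\<eta><M. \<Sum>a<P. \<Sum>b<P.
    \<Sum>s<N. \<Sum>c<P. \<Sum>s'<N. \<Sum>d<P. LB \<eta> $$ (i * P + b, s * P + c) *
      \<epsilon> (channel_input N \<mu> (LA \<eta>) \<rho> a c d) $$ (s, s') * cnj (LB \<eta> $$ (j * P + b, s' * P + d)))"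
proof -
  have "(kron (1\<^sub>m P) (LB \<eta>) * chan_mid P N P \<epsilon> X * adj (kron (1\<^sub>m P) (LB \<eta>))) $$ ((a * N + i) * P + b, (a * N + j) * P + b) =
    (\<Sum>s<N. \<Sum>c<P. \<Sum>s'<N. \<Sum>d<P. LB \<eta> $$ (i * P + b, s * P + c) *
      chan_mid P N P \<epsilon> X $$ ((a * N + s) * P + c, (a * N + s') * P + d) * cnj (LB \<eta> $$ (j * P + b, s' * P + d)))"
    if "\<eta> < M" "a < P" "b < P" for \<eta> a b X
  proof -
    have Z: "chan_mid P N P \<epsilon> X \<in> carrier_mat (P * (N * P)) (P * (N * P))"
      by (simp add: chan_mid_def mult.assoc)
    \<comment> \<open>The three-factor index is regrouped with a outside and B, b as one block, the
      layout in which Bob's operator is a Kronecker product.\<close>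
    have e: "(a * N + k) * P + c = a * (N * P) + (k * P + c)" for k c
      by (simp add: algebra_simps)
    show ?thesis
      unfolding e using that ij
      by (subst kron_one_left_conj_entry[OF LB Z]) (simp_all add: sum_lessThan_prod pair_index_less)
  qed
  then show ?thesis
    using ij unfolding protocol_out_def msum_def ptrace_outer_def
    by (simp add: chan_mid_channel_input[OF LA])
qed

section \<open>Necessity\<close>

text \<open>Used with \<open>E\<close> the Choi matrix, \<open>Y\<close> and \<open>Z\<close>
  Alice's amplitudes and \<open>A\<close> and \<open>B\<close> Bob's entries: the tested output of
  one branch becomes a Choi form at one collected vector.\<close>

lemma sum_rearrange:
  fixes x z :: "nat \<Rightarrow> complex"
  shows "(\<Sum>i\<in>I. \<Sum>j\<in>J. x i * (\<Sum>s\<in>S. \<Sum>c\<in>C. \<Sum>t\<in>T. \<Sum>d\<in>D.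
      A i s c * (\<Sum>k\<in>K. \<Sum>l\<in>L. Y c k * Z d l * E s k t l) * B j t d) * z j) =
    (\<Sum>s\<in>S. \<Sum>k\<in>K. \<Sum>t\<in>T. \<Sum>l\<in>L. (\<Sum>i\<in>I. \<Sum>c\<in>C. x i * (A i s c * Y c k)) * E s k t l *
      (\<Sum>j\<in>J. \<Sum>d\<in>D. z j * (B j t d * Z d l)))"
proof -
  \<comment> \<open>sorts both nestings into one order of summation\<close>
  note swaps = sum.swap[of _ S I] sum.swap[of _ S J] sum.swap[of _ K I] sum.swap[of _ K J] sum.swap[of _ K C]
    sum.swap[of _ K T] sum.swap[of _ K D] sum.swap[of _ T I] sum.swap[of _ T J] sum.swap[of _ T C]
    sum.swap[of _ L I] sum.swap[of _ L J] sum.swap[of _ L C] sum.swap[of _ L D] sum.swap[of _ C J]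
    sum.swap[of _ I J] sum.swap[of _ I D] sum.swap[of _ C D] sum.swap[of _ S D] sum.swap[of _ S C] sum.swap[of _ T D]
  show ?thesis
    by (simp only: sum_distrib_left sum_distrib_right swaps, intro sum.cong refl) (simp add: mult_ac)
qed

lemma density_rank_one:
  assumes "(\<Sum>i<N. (cmod (\<phi> i))\<^sup>2) = 1"
  shows "density N (mat N N (\<lambda>(i, j). \<phi> i * cnj (\<phi> j)))"
proof -
  have "qform N (\<lambda>i j. mat N N (\<lambda>(i, j). \<phi> i * cnj (\<phi> j)) $$ (i, j)) v = qform N (\<lambda>i j. \<phi> i * cnj (\<phi> j)) v" for v
    unfolding qform_def by (intro sum.cong) auto
  then have "psd N (mat N N (\<lambda>(i, j). \<phi> i * cnj (\<phi> j)))"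
    using psd_form_rank_one[of N \<phi>] unfolding psd_iff_psd_form psd_form_def by simp
  moreover have "mtrace (mat N N (\<lambda>(i, j). \<phi> i * cnj (\<phi> j))) = of_real (\<Sum>i<N. (cmod (\<phi> i))\<^sup>2)"
    by (simp add: mtrace_def complex_norm_square del: of_real_power)
  ultimately show ?thesis unfolding density_def assms by simp
qed

text \<open>Purity of the input is what makes each branch value a Choi form at a single
  vector.\<close>

lemma channel_input_rank_one:
  assumes "k < N" "l < N"
  shows "channel_input N \<mu> L (mat N N (\<lambda>(i, j). \<phi> i * cnj (\<phi> j))) a b b' $$ (k, l) =
    (\<Sum>j<N. L $$ (a * N + k, b * N + j) * \<mu> b * \<phi> j) * cnj (\<Sum>j<N. L $$ (a * N + l, b' * N + j) * \<mu> b' * \<phi> j)"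
  using assms unfolding channel_input_def
  by (simp add: sum_product cnj_sum mult_ac)

lemma det_faithful_carriers:
  assumes "det_faithful N P \<epsilon> \<mu> M LA LB" "\<eta> < M"
  shows "LA \<eta> \<in> carrier_mat (P * N) (P * N)" "LB \<eta> \<in> carrier_mat (N * P) (N * P)"
proof -
  obtain Q U where "projection_mat (P * N) Q" "unitary_mat (P * N) U" "LA \<eta> = Q * U"
    using assms unfolding det_faithful_def by blast
  then show "LA \<eta> \<in> carrier_mat (P * N) (P * N)"
    unfolding projection_mat_def unitary_mat_def by (metis mult_carrier_mat)
  show "LB \<eta> \<in> carrier_mat (N * P) (N * P)"
    using assms unfolding det_faithful_def unitary_mat_def by blast
qed

locale faithful_protocol =
  fixes N P M :: nat and \<epsilon> :: "complex mat \<Rightarrow> complex mat" and \<mu> :: "nat \<Rightarrow> real"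
    and LA LB :: "nat \<Rightarrow> complex mat"
  assumes N2: "N \<ge> 2" and eps: "cptp N \<epsilon>" and rank: "\<forall>m K. kraus_rep N \<epsilon> m K \<longrightarrow> N\<^sup>2 \<le> m"
    and schmidt: "schmidt_coeffs P \<mu>" and faithful: "det_faithful N P \<epsilon> \<mu> M LA LB"
begin

lemmas LA_carrier = det_faithful_carriers(1)[OF faithful]
lemmas LB_carrier = det_faithful_carriers(2)[OF faithful]

text \<open>
  Entry \<open>(i, j)\<close> of \<open>\<langle>a|\<langle>b| LB K LA |\<psi>\<rangle>\<close>, an operator from A to B, where the matrix unit \<open>K = |s\<rangle>\<langle>k|\<close>
  takes the place of the channel.
\<close>

definition branch :: "nat \<Rightarrow> nat \<Rightarrow> nat \<Rightarrow> nat \<Rightarrow> nat \<Rightarrow> nat \<Rightarrow> nat \<Rightarrow> complex" where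
  "branch \<eta> a b s k i j = (\<Sum>c<P. LB \<eta> $$ (i * P + b, s * P + c) * (LA \<eta> $$ (a * N + k, c * N + j) * \<mu> c))"

text \<open>The output equals the pure input, so its expectation in \<open>\<chi>\<close> vanishes;
  that expectation is a sum of nonnegative Choi forms, and definiteness kills the vector of each
  branch.\<close>

lemma branch_orthogonal:
  assumes norm: "(\<Sum>i<N. (cmod (\<phi> i))\<^sup>2) = 1" and orth: "(\<Sum>i<N. cnj (\<chi> i) * \<phi> i) = 0"
    and ix: "\<eta> < M" "a < P" "b < P" "s < N" "k < N"
  shows "(\<Sum>i<N. \<Sum>j<N. cnj (\<chi> i) * branch \<eta> a b s k i j * \<phi> j) = 0"
proof -
  define \<rho> where "\<rho> = mat N N (\<lambda>(i, j). \<phi> i * cnj (\<phi> j))"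
  define y where "y \<eta> a c k = (\<Sum>j<N. LA \<eta> $$ (a * N + k, c * N + j) * \<mu> c * \<phi> j)" for \<eta> a c k
  define W where "W \<eta> a b s k = (\<Sum>i<N. \<Sum>c<P. cnj (\<chi> i) * (LB \<eta> $$ (i * P + b, s * P + c) * y \<eta> a c k))" for \<eta> a b s k
  \<comment> \<open>The argument is conjugated because \<open>qform\<close> conjugates its left
    slot, where \<open>W\<close> itself has to appear.\<close>
  define q where "q \<eta> a b = qform (N * N) (choi N \<epsilon>) (\<lambda>r. cnj (W \<eta> a b (r div N) (r mod N)))" for \<eta> a b
  have qform_eq: "q \<eta> a b = (\<Sum>s<N. \<Sum>k<N. \<Sum>t<N. \<Sum>l<N. W \<eta> a b s k * choi N \<epsilon> (s * N + k) (t * N + l) * cnj (W \<eta> a b t l))" for \<eta> a b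
    unfolding q_def qform_def by (simp add: sum_lessThan_prod)
  have out: "protocol_out N P \<epsilon> \<mu> M LA LB \<rho> = \<rho>"
    using faithful density_rank_one[OF norm] unfolding det_faithful_def \<rho>_def by blast
  have eps_in: "\<epsilon> (channel_input N \<mu> (LA \<eta>) \<rho> a c d) $$ (s, t) =
      (\<Sum>k<N. \<Sum>l<N. y \<eta> a c k * cnj (y \<eta> a d l) * choi N \<epsilon> (s * N + k) (t * N + l))"
    if "s < N" "t < N" for \<eta> a c d s t
    unfolding cptp_entry[OF eps channel_input_carrier that] \<rho>_def y_def
    by (intro sum.cong refl) (simp add: channel_input_rank_one)
  have "0 = (\<Sum>i<N. cnj (\<chi> i) * \<phi> i) * (\<Sum>j<N. cnj (\<phi> j) * \<chi> j)"
    using orth by simp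
  also have "\<dots> = (\<Sum>i<N. \<Sum>j<N. cnj (\<chi> i) * protocol_out N P \<epsilon> \<mu> M LA LB \<rho> $$ (i, j) * \<chi> j)"
    unfolding out sum_product by (intro sum.cong refl) (simp add: \<rho>_def)
  also have "\<dots> = (\<Sum>i<N. \<Sum>j<N. cnj (\<chi> i) * (\<Sum>\<eta><M. \<Sum>a<P. \<Sum>b<P.
      \<Sum>s<N. \<Sum>c<P. \<Sum>t<N. \<Sum>d<P. LB \<eta> $$ (i * P + b, s * P + c) *
      (\<Sum>k<N. \<Sum>l<N. y \<eta> a c k * cnj (y \<eta> a d l) * choi N \<epsilon> (s * N + k) (t * N + l)) *
      cnj (LB \<eta> $$ (j * P + b, t * P + d))) * \<chi> j)"
    by (intro sum.cong refl) (simp add: protocol_out_entry[OF LA_carrier LB_carrier] eps_in)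
  also have "\<dots> = (\<Sum>\<eta><M. \<Sum>a<P. \<Sum>b<P. \<Sum>i<N. \<Sum>j<N. cnj (\<chi> i) * (
      \<Sum>s<N. \<Sum>c<P. \<Sum>t<N. \<Sum>d<P. LB \<eta> $$ (i * P + b, s * P + c) *
      (\<Sum>k<N. \<Sum>l<N. y \<eta> a c k * cnj (y \<eta> a d l) * choi N \<epsilon> (s * N + k) (t * N + l)) *
      cnj (LB \<eta> $$ (j * P + b, t * P + d))) * \<chi> j)"
    by (simp only: sum_distrib_left[where A = "{..<M}"] sum_distrib_right[where A = "{..<M}"]
         sum_distrib_left[where A = "{..<P}" and r = "cnj _"]
         sum_distrib_right[where A = "{..<P}" and r = "\<chi> _"]
         sum.swap[of _ "{..<M}" "{..<N}"] sum.swap[of _ "{..<P}" "{..<N}"])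
  also have "\<dots> = (\<Sum>\<eta><M. \<Sum>a<P. \<Sum>b<P. q \<eta> a b)"
    unfolding qform_eq W_def sum_rearrange by simp
  finally have sum0: "(\<Sum>\<eta><M. \<Sum>a<P. \<Sum>b<P. q \<eta> a b) = 0" ..
  have q: "Im (q \<eta> a b) = 0" "Re (q \<eta> a b) \<ge> 0" for \<eta> a b
    using psd_form_choi[OF eps] unfolding psd_form_def q_def by blast+
  have "(\<Sum>\<eta><M. \<Sum>a<P. \<Sum>b<P. Re (q \<eta> a b)) = 0"
    using arg_cong[OF sum0, of Re] by simp
  then have "Re (q \<eta> a b) = 0"
    using ix q by (simp add: sum_nonneg_eq_0_iff sum_nonneg)
  then have "q \<eta> a b = 0" using q by (simp add: complex_eq_iff)
  then have "W \<eta> a b ((s * N + k) div N) ((s * N + k) mod N) = 0"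
    using choi_definite[OF eps rank, of _ "s * N + k"] ix unfolding q_def
    by (metis complex_cnj_zero_iff pair_index_less)
  then have "W \<eta> a b s k = 0" using ix by simp
  moreover have "W \<eta> a b s k = (\<Sum>i<N. \<Sum>j<N. cnj (\<chi> i) * branch \<eta> a b s k i j * \<phi> j)"
    unfolding W_def y_def branch_def sum_distrib_left sum_distrib_right
    by (rule sum.cong[OF refl], subst sum.swap) (simp add: mult_ac)
  ultimately show ?thesis by simp
qed

text \<open>An operator whose matrix elements between orthogonal vectors all vanish is scalar: basis
  vectors clear the off-diagonal, and a sum tested against a difference equates two diagonal
  entries.\<close>

lemma branch_scalar:
  assumes ix: "\<eta> < M" "a < P" "b < P" "s < N" "k < N"
  shows "\<exists>g. \<forall>i<N. \<forall>j<N. branch \<eta> a b s k i j = (if i = j then g else 0)"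
proof -
  let ?G = "branch \<eta> a b s k"
  have off: "?G i j = 0" if ij: "i < N" "j < N" "i \<noteq> j" for i j
  proof -
    have "(\<Sum>l<N. \<Sum>m<N. cnj (if l = i then 1 else 0) * ?G l m * (if m = j then 1 else 0)) = 0"
    proof (rule branch_orthogonal[OF _ _ ix])
      show "(\<Sum>l<N. (cmod (if l = j then 1 else 0))\<^sup>2) = 1"
        using ij by (subst sum_lessThan_single[of j]) simp_all
      show "(\<Sum>l<N. cnj (if l = i then 1 else 0) * (if l = j then 1 else 0)) = 0"
        using ij by (intro sum.neutral) auto
    qed
    also have "(\<Sum>l<N. \<Sum>m<N. cnj (if l = i then 1 else 0) * ?G l m * (if m = j then 1 else 0)) = ?G i j"
      using ij by (subst sum_lessThan_single[of i], simp, simp, subst sum_lessThan_single[of j]) simp_all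
    finally show ?thesis .
  qed
  have diag: "?G i i = ?G 0 0" if i: "i < N" "i \<noteq> 0" for i
  proof -
    \<comment> \<open>\<open>\<phi>\<close> is a unit vector because it is fed in as a state,
      whereas \<open>\<chi>\<close> is only a test vector.\<close>
    define \<phi> :: "nat \<Rightarrow> complex" where "\<phi> l = (if l = i then of_real (1 / sqrt 2) else if l = 0 then - of_real (1 / sqrt 2) else 0)" for l
    define \<chi> :: "nat \<Rightarrow> complex" where "\<chi> l = (if l = i then 1 else if l = 0 then 1 else 0)" for l
    have two: "(\<Sum>l<N. f l) = f 0 + f i" if "\<And>l. l \<noteq> i \<Longrightarrow> l \<noteq> 0 \<Longrightarrow> f l = 0" for f :: "nat \<Rightarrow> 'z::comm_monoid_add"
      using that i sum.mono_neutral_right[of "{..<N}" "{0, i}" f] by auto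
    have "(\<Sum>l<N. (cmod (\<phi> l))\<^sup>2) = 1"
      using i by (subst two) (auto simp: \<phi>_def norm_divide power_divide)
    moreover have "(\<Sum>l<N. cnj (\<chi> l) * \<phi> l) = 0"
      using i by (subst two) (auto simp: \<phi>_def \<chi>_def)
    ultimately have "(\<Sum>l<N. \<Sum>m<N. cnj (\<chi> l) * ?G l m * \<phi> m) = 0"
      by (rule branch_orthogonal[OF _ _ ix])
    also have "(\<Sum>l<N. \<Sum>m<N. cnj (\<chi> l) * ?G l m * \<phi> m) = (\<Sum>m<N. ?G 0 m * \<phi> m) + (\<Sum>m<N. ?G i m * \<phi> m)"
      using i by (subst two) (auto simp: \<chi>_def)
    also have "(\<Sum>m<N. ?G 0 m * \<phi> m) = - ?G 0 0 * of_real (1 / sqrt 2)"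
      using i off[of 0 i] by (subst two) (auto simp: \<phi>_def)
    also have "(\<Sum>m<N. ?G i m * \<phi> m) = ?G i i * of_real (1 / sqrt 2)"
      using i off[of i 0] by (subst two) (auto simp: \<phi>_def)
    finally have "(?G i i - ?G 0 0) * of_real (1 / sqrt 2) = 0" by (simp add: algebra_simps)
    then show ?thesis by simp
  qed
  show ?thesis using off diag by metis
qed

end

section \<open>Multiples of isometries\<close>

lemma sum_swap4:
  "(\<Sum>i\<in>I. \<Sum>b\<in>B. \<Sum>c\<in>C. \<Sum>d\<in>D. f i b c d) = (\<Sum>c\<in>C. \<Sum>d\<in>D. \<Sum>i\<in>I. \<Sum>b\<in>B. f i b c d)"
  by (simp only: sum.swap[of _ C B] sum.swap[of _ D B] sum.swap[of _ C I] sum.swap[of _ D I])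

lemma adj_mult_self_entry:
  assumes "A \<in> carrier_mat n m" "i < m" "j < m"
  shows "(adj A * A) $$ (i, j) = (\<Sum>k<n. cnj (A $$ (k, i)) * A $$ (k, j))"
  using assms by (subst mult_entry[of _ m n]) (simp_all add: adj_entry)

text \<open>The \<open>P \<times> N\<close> matrix \<open>T\<close> is \<open>\<surd>c\<close> times an isometry.\<close>

definition gram_scalar :: "nat \<Rightarrow> nat \<Rightarrow> (nat \<Rightarrow> nat \<Rightarrow> complex) \<Rightarrow> real \<Rightarrow> bool" where
  "gram_scalar P N T c \<longleftrightarrow> (\<forall>j<N. \<forall>j'<N. (\<Sum>b<P. cnj (T b j) * T b j') = (if j = j' then of_real c else 0))"

lemma gram_scalarD:
  "gram_scalar P N T c \<Longrightarrow> j < N \<Longrightarrow> j' < N \<Longrightarrow> (\<Sum>b<P. cnj (T b j) * T b j') = (if j = j' then of_real c else 0)"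
  unfolding gram_scalar_def by blast

lemma gram_scalar_const:
  assumes "gram_scalar P N T c" "j < N"
  shows "c = (\<Sum>b<P. (cmod (T b j))\<^sup>2)"
proof -
  have "complex_of_real c = of_real (\<Sum>b<P. (cmod (T b j))\<^sup>2)"
    using gram_scalarD[OF assms(1,2,2)] by (simp add: complex_norm_square mult.commute del: of_real_power)
  then show ?thesis by (simp only: of_real_eq_iff)
qed

lemma gram_scalar_apply:
  assumes "gram_scalar P N T c" "i < N"
  shows "(\<Sum>b<P. cnj (T b i) * (\<Sum>j<N. T b j * x j)) = of_real c * x i"
proof -
  have "(\<Sum>b<P. cnj (T b i) * (\<Sum>j<N. T b j * x j)) = (\<Sum>j<N. (\<Sum>b<P. cnj (T b i) * T b j) * x j)"
    by (simp add: sum_distrib_left sum_distrib_right sum.swap[of _ "{..<N}"] mult_ac)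
  also have "\<dots> = (\<Sum>j<N. if j = i then of_real c * x i else 0)"
    using assms by (intro sum.cong refl) (auto simp: gram_scalarD)
  finally show ?thesis using assms(2) by simp
qed

text \<open>This is \<open>T * adj T \<le> c\<close> on the diagonal: if \<open>u\<close> is column
  \<open>b\<close> of \<open>T * adj T\<close>, then the square of \<open>u b = S\<close> is at most
  the squared norm of \<open>u\<close>, which is \<open>c * S\<close>.\<close>

lemma gram_scalar_row_bound:
  assumes gram: "gram_scalar P N T c" and b: "b < P" and N: "N > 0"
  shows "(\<Sum>j<N. (cmod (T b j))\<^sup>2) \<le> c"
proof -
  define S where "S = (\<Sum>j<N. (cmod (T b j))\<^sup>2)"
  define u where "u d = (\<Sum>j<N. T d j * cnj (T b j))" for d
  have c: "c \<ge> 0" unfolding gram_scalar_const[OF gram N] by (simp add: sum_nonneg)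
  have S: "S \<ge> 0" unfolding S_def by (simp add: sum_nonneg)
  have ub: "u b = of_real S"
    unfolding u_def S_def by (simp add: complex_norm_square del: of_real_power)
  have "complex_of_real (\<Sum>d<P. (cmod (u d))\<^sup>2) = (\<Sum>d<P. cnj (u d) * u d)"
    by (simp add: complex_norm_square mult.commute del: of_real_power)
  also have "\<dots> = (\<Sum>i<N. T b i * (\<Sum>d<P. cnj (T d i) * u d))"
    by (subst (1) u_def) (simp add: cnj_sum sum_distrib_left sum_distrib_right sum.swap[of _ "{..<N}"] mult_ac)
  also have "\<dots> = (\<Sum>i<N. T b i * (of_real c * cnj (T b i)))"
    unfolding u_def by (intro sum.cong refl) (simp add: gram_scalar_apply[OF gram])
  also have "\<dots> = of_real (c * S)"
    unfolding S_def by (simp add: complex_norm_square sum_distrib_left mult_ac del: of_real_power)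
  finally have "(\<Sum>d<P. (cmod (u d))\<^sup>2) = c * S" by (simp only: of_real_eq_iff)
  moreover have "(cmod (u b))\<^sup>2 \<le> (\<Sum>d<P. (cmod (u d))\<^sup>2)"
    using b by (intro member_le_sum) auto
  ultimately have "S * S \<le> c * S" unfolding ub using S by (simp add: power2_eq_square)
  then show ?thesis unfolding S_def[symmetric] using S c
    by (cases "S = 0") (auto simp: mult_le_cancel_right)
qed

text \<open>Bob's half of the conversion: every outcome turns the conjugate of \<open>T\<close> into
  a multiple of the identity, possibly zero, which makes the joint state proportional to the
  maximally entangled one.\<close>

lemma gram_scalar_instrument:
  assumes gram: "gram_scalar P N T c" and N: "N > 0"
  obtains L :: "nat \<Rightarrow> complex mat" where
    "\<And>l. l < Suc P \<Longrightarrow> L l \<in> carrier_mat N P"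
    "msum P P (Suc P) (\<lambda>l. adj (L l) * L l) = 1\<^sub>m P"
    "\<And>l. l < Suc P \<Longrightarrow> \<exists>d. \<forall>i<N. \<forall>i'<N. (\<Sum>b<P. cnj (T b i) * L l $$ (i', b)) = (if i = i' then d else 0)"
proof -
  have c: "c \<ge> 0" unfolding gram_scalar_const[OF gram N] by (simp add: sum_nonneg)
  \<comment> \<open>For \<open>c = 0\<close> all column norms are zero, so \<open>TG\<close> below
    stays true although \<open>G\<close> is then 0.\<close>
  have T0: "T b j = 0" if "c = 0" "b < P" "j < N" for b j
    using gram_scalar_const[OF gram that(3)] that by (simp add: sum_nonneg_eq_0_iff)
  have sqrtc: "complex_of_real (sqrt c) * complex_of_real (sqrt c) = of_real c"
    using c by (simp flip: of_real_mult)
  \<comment> \<open>\<open>G\<close> projects onto the range of \<open>T\<close>. Outcome \<open>P\<close> inverts the isometry, the outcomes \<open>l < P\<close>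
    are the rows of \<open>1 - G\<close>. For \<open>c = 0\<close> the convention \<open>x / 0 = 0\<close> gives \<open>G = 0\<close>, as needed.\<close>
  define G where "G b d = (\<Sum>j<N. T b j * cnj (T d j)) / of_real c" for b d
  define Q where "Q l b = (if l = b then 1 else 0) - G b l" for l b
  define L where "L l = mat N P (\<lambda>(i, b). if l = P then T b i / of_real (sqrt c) else if i = 0 then Q l b else 0)" for l
  have cnj_G: "cnj (G b d) = G d b" for b d
    unfolding G_def by (simp add: cnj_sum mult.commute)
  have TG: "(\<Sum>b<P. cnj (T b i) * G b l) = cnj (T l i)" if "i < N" "l < P" for i l
  proof -
    have "(\<Sum>b<P. cnj (T b i) * G b l) = (\<Sum>b<P. cnj (T b i) * (\<Sum>j<N. T b j * cnj (T l j))) / of_real c"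
      unfolding G_def times_divide_eq_right sum_divide_distrib[symmetric] ..
    then show ?thesis
      unfolding gram_scalar_apply[OF gram that(1)] using T0[OF _ that(2,1)] by (cases "c = 0") auto
  qed
  have GG: "(\<Sum>l<P. G b l * G l d) = G b d" if "b < P" "d < P" for b d
  proof -
    have "(\<Sum>l<P. G b l * G l d) = (\<Sum>j<N. T b j * (\<Sum>l<P. cnj (T l j) * G l d)) / of_real c"
      unfolding G_def[of b] times_divide_eq_left sum_divide_distrib[symmetric] sum_distrib_left sum_distrib_right
      by (subst sum.swap) (simp add: mult_ac)
    also have "\<dots> = G b d" using that unfolding G_def[of b] by (simp add: TG)
    finally show ?thesis .
  qed
  show thesis
  proof (rule that[of L])
    show car: "L l \<in> carrier_mat N P" for l by (simp add: L_def)
    show "msum P P (Suc P) (\<lambda>l. adj (L l) * L l) = 1\<^sub>m P"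
    proof (rule eq_matI)
      fix b d assume "b < dim_row (1\<^sub>m P :: complex mat)" "d < dim_col (1\<^sub>m P :: complex mat)"
      then have bd: "b < P" "d < P" by auto
      have "msum P P (Suc P) (\<lambda>l. adj (L l) * L l) $$ (b, d) =
         (\<Sum>l<P. \<Sum>k<N. cnj (L l $$ (k, b)) * L l $$ (k, d)) + (\<Sum>k<N. cnj (L P $$ (k, b)) * L P $$ (k, d))"
        using bd by (simp add: msum_def adj_mult_self_entry[OF car] del: index_mult_mat)
      also have "(\<Sum>k<N. cnj (L P $$ (k, b)) * L P $$ (k, d)) = G d b"
        unfolding G_def L_def using bd sqrtc by (simp add: sum_divide_distrib mult_ac)
      \<comment> \<open>Outcomes below \<open>P\<close> are single rows stored in row 0 of an
        \<open>N\<close> by \<open>P\<close> matrix, so one inner term survives.\<close>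
      also have "(\<Sum>l<P. \<Sum>k<N. cnj (L l $$ (k, b)) * L l $$ (k, d)) = (\<Sum>l<P. cnj (Q l b) * Q l d)"
      proof (rule sum.cong[OF refl])
        fix l assume "l \<in> {..<P}"
        then show "(\<Sum>k<N. cnj (L l $$ (k, b)) * L l $$ (k, d)) = cnj (Q l b) * Q l d"
          using N bd by (subst sum_lessThan_single[of 0]) (auto simp: L_def)
      qed
      \<comment> \<open>The entrywise form of \<open>(1 - G)^2 = 1 - G\<close>, which complements
        the term \<open>G d b\<close> of outcome \<open>P\<close>.\<close>
      also have "\<dots> = (\<Sum>l<P. (if l = b then (if b = d then 1 else 0) - G d b else 0) - (if l = d then G d b else 0) + G d l * G l b)"
        by (intro sum.cong refl) (auto simp: Q_def cnj_G algebra_simps)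
      also have "\<dots> = (if b = d then 1 else 0) - G d b"
        using bd by (simp add: sum.distrib sum_subtractf GG)
      finally show "msum P P (Suc P) (\<lambda>l. adj (L l) * L l) $$ (b, d) = 1\<^sub>m P $$ (b, d)"
        using bd by simp
    qed (simp_all add: msum_def)
    fix l assume l: "l < Suc P"
    show "\<exists>d. \<forall>i<N. \<forall>i'<N. (\<Sum>b<P. cnj (T b i) * L l $$ (i', b)) = (if i = i' then d else 0)"
    proof (cases "l = P")
      case True
      have "(\<Sum>b<P. cnj (T b i) * L l $$ (i', b)) = (if i = i' then of_real c / of_real (sqrt c) else 0)"
        if "i < N" "i' < N" for i i'
      proof -
        have "(\<Sum>b<P. cnj (T b i) * L l $$ (i', b)) = (\<Sum>b<P. cnj (T b i) * T b i') / of_real (sqrt c)"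
          using True that by (simp add: L_def sum_divide_distrib)
        then show ?thesis using gram_scalarD[OF gram that] by simp
      qed
      then show ?thesis by blast
    next
      case False
      then have lP: "l < P" using l by simp
      \<comment> \<open>The columns of \<open>T\<close> lie in the range of \<open>G\<close>, so
        outcomes below \<open>P\<close> have amplitude zero.\<close>
      have "(\<Sum>b<P. cnj (T b i) * L l $$ (i', b)) = 0" if "i < N" "i' < N" for i i'
      proof (cases "i' = 0")
        case True
        have "(\<Sum>b<P. cnj (T b i) * L l $$ (i', b)) = (\<Sum>b<P. (if b = l then cnj (T l i) else 0) - cnj (T b i) * G b l)"
          using False True that by (intro sum.cong refl) (auto simp: L_def Q_def algebra_simps)
        then show ?thesis using lP TG[OF that(1) lP] by (simp add: sum_subtractf)
      qed (use False that in \<open>simp add: L_def\<close>)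
      then show ?thesis by auto
    qed
  qed
qed

section \<open>Alice's rows and the Schmidt coefficients\<close>

context faithful_protocol
begin

definition T :: "nat \<Rightarrow> nat \<Rightarrow> nat \<Rightarrow> nat \<Rightarrow> complex" where
  "T \<eta> r b j = LA \<eta> $$ (r, b * N + j) * \<mu> b"

lemma LB_columns:
  assumes "\<eta> < M" "s < N" "c < P" "d < P"
  shows "(\<Sum>i<N. \<Sum>b<P. cnj (LB \<eta> $$ (i * P + b, s * P + c)) * LB \<eta> $$ (i * P + b, s * P + d)) = (if c = d then 1 else 0)"
proof -
  have "adj (LB \<eta>) * LB \<eta> = 1\<^sub>m (N * P)"
    using faithful assms unfolding det_faithful_def unitary_mat_def by blast
  then have "(\<Sum>k<N * P. cnj (LB \<eta> $$ (k, s * P + c)) * LB \<eta> $$ (k, s * P + d)) = 1\<^sub>m (N * P) $$ (s * P + c, s * P + d)"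
    using adj_mult_self_entry[OF LB_carrier[OF assms(1)], of "s * P + c" "s * P + d"] assms
    by (simp add: pair_index_less del: index_one_mat)
  then show ?thesis using assms by (simp add: sum_lessThan_prod pair_index_less)
qed

lemma LA_columns:
  assumes "x < P * N" "y < P * N"
  shows "(\<Sum>\<eta><M. \<Sum>r<P * N. cnj (LA \<eta> $$ (r, x)) * LA \<eta> $$ (r, y)) = (if x = y then 1 else 0)"
proof -
  have "msum (P * N) (P * N) M (\<lambda>\<eta>. adj (LA \<eta>) * LA \<eta>) = 1\<^sub>m (P * N)"
    using faithful unfolding det_faithful_def by blast
  then have "msum (P * N) (P * N) M (\<lambda>\<eta>. adj (LA \<eta>) * LA \<eta>) $$ (x, y) = 1\<^sub>m (P * N) $$ (x, y)"
    by (simp only:)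
  then have "(\<Sum>\<eta><M. (adj (LA \<eta>) * LA \<eta>) $$ (x, y)) = 1\<^sub>m (P * N) $$ (x, y)"
    using assms by (simp add: msum_def del: index_mult_mat index_one_mat)
  moreover have "(\<Sum>\<eta><M. (adj (LA \<eta>) * LA \<eta>) $$ (x, y)) = (\<Sum>\<eta><M. \<Sum>r<P * N. cnj (LA \<eta> $$ (r, x)) * LA \<eta> $$ (r, y))"
    using assms by (intro sum.cong refl) (simp add: adj_mult_self_entry[OF LA_carrier] del: index_mult_mat)
  ultimately show ?thesis using assms by simp
qed

text \<open>With \<open>|0><k|\<close> in place of the channel each branch is scalar; summing
  products of branches over Bob's outputs cancels his unitary and leaves the Gram matrix of the
  rows.\<close>

lemma T_gram:
  assumes \<eta>: "\<eta> < M" and r: "r < P * N" "r' < P * N"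
  shows "\<exists>g. \<forall>j<N. \<forall>j'<N. (\<Sum>b<P. cnj (T \<eta> r b j) * T \<eta> r' b j') = (if j = j' then g else 0)"
proof -
  have N0: "0 < N" using N2 by simp
  define a k where "a = r div N" and "k = r mod N"
  define a' k' where "a' = r' div N" and "k' = r' mod N"
  have ak: "r = a * N + k" "r' = a' * N + k'" "a < P" "k < N" "a' < P" "k' < N"
    using r N0 by (simp_all add: a_def k_def a'_def k'_def less_mult_imp_div_less)
  have "\<forall>b. \<exists>g. b < P \<longrightarrow> (\<forall>i<N. \<forall>j<N. branch \<eta> a b 0 k i j = (if i = j then g else 0))"
    using branch_scalar[OF \<eta> ak(3) _ N0 ak(4)] by blast
  then obtain g where g: "\<And>b i j. b < P \<Longrightarrow> i < N \<Longrightarrow> j < N \<Longrightarrow> branch \<eta> a b 0 k i j = (if i = j then g b else 0)"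
    by metis
  have "\<forall>b. \<exists>g. b < P \<longrightarrow> (\<forall>i<N. \<forall>j<N. branch \<eta> a' b 0 k' i j = (if i = j then g else 0))"
    using branch_scalar[OF \<eta> ak(5) _ N0 ak(6)] by blast
  then obtain g' where g': "\<And>b i j. b < P \<Longrightarrow> i < N \<Longrightarrow> j < N \<Longrightarrow> branch \<eta> a' b 0 k' i j = (if i = j then g' b else 0)"
    by metis
  have "(\<Sum>b<P. cnj (T \<eta> r b j) * T \<eta> r' b j') = (if j = j' then \<Sum>b<P. cnj (g b) * g' b else 0)"
    if j: "j < N" "j' < N" for j j'
  proof -
    let ?V = "\<lambda>i b c. LB \<eta> $$ (i * P + b, 0 * P + c)"
    have "(\<Sum>i<N. \<Sum>b<P. cnj (branch \<eta> a b 0 k i j) * branch \<eta> a' b 0 k' i j') =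
      (\<Sum>i<N. \<Sum>b<P. \<Sum>c<P. \<Sum>d<P. cnj (T \<eta> r c j) * T \<eta> r' d j' * (cnj (?V i b c) * ?V i b d))"
      unfolding branch_def cnj_sum sum_product T_def ak by (intro sum.cong refl) (simp add: mult_ac)
    also have "\<dots> = (\<Sum>c<P. \<Sum>d<P. cnj (T \<eta> r c j) * T \<eta> r' d j' * (\<Sum>i<N. \<Sum>b<P. cnj (?V i b c) * ?V i b d))"
      by (subst sum_swap4) (simp only: sum_distrib_left)
    also have "\<dots> = (\<Sum>c<P. cnj (T \<eta> r c j) * T \<eta> r' c j')"
    proof (rule sum.cong[OF refl])
      fix c assume "c \<in> {..<P}"
      then show "(\<Sum>d<P. cnj (T \<eta> r c j) * T \<eta> r' d j' * (\<Sum>i<N. \<Sum>b<P. cnj (?V i b c) * ?V i b d)) =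
          cnj (T \<eta> r c j) * T \<eta> r' c j'"
        by (subst sum_lessThan_single[of c]) (simp_all only: LB_columns[OF \<eta> N0] lessThan_iff, simp_all)
    qed
    finally have "(\<Sum>b<P. cnj (T \<eta> r b j) * T \<eta> r' b j') =
        (\<Sum>i<N. \<Sum>b<P. cnj (branch \<eta> a b 0 k i j) * branch \<eta> a' b 0 k' i j')" ..
    also have "\<dots> = (\<Sum>i<N. \<Sum>b<P. (if i = j then cnj (g b) else 0) * (if i = j' then g' b else 0))"
      using j by (intro sum.cong refl) (simp add: g g')
    also have "\<dots> = (\<Sum>b<P. (if j = j then cnj (g b) else 0) * (if j = j' then g' b else 0))"
      using j by (intro sum_lessThan_single) auto
    finally show ?thesis by simp
  qed
  then show ?thesis by blast
qed

text \<open>The constant of row \<open>r\<close> as a multiple of an isometry; column 0 stands for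
  every column by \<open>T_gram_scalar\<close>.\<close>

definition weight :: "nat \<Rightarrow> nat \<Rightarrow> real" where
  "weight \<eta> r = (\<Sum>b<P. (cmod (T \<eta> r b 0))\<^sup>2)"

lemma T_gram_scalar:
  assumes "\<eta> < M" "r < P * N"
  shows "gram_scalar P N (T \<eta> r) (weight \<eta> r)"
proof -
  obtain g where g: "\<forall>j<N. \<forall>j'<N. (\<Sum>b<P. cnj (T \<eta> r b j) * T \<eta> r b j') = (if j = j' then g else 0)"
    using T_gram[OF assms assms(2)] by blast
  have "g = (\<Sum>b<P. cnj (T \<eta> r b 0) * T \<eta> r b 0)"
    using g N2 by simp
  also have "\<dots> = of_real (weight \<eta> r)"
    by (simp add: weight_def complex_norm_square mult.commute del: of_real_power)
  finally show ?thesis using g unfolding gram_scalar_def by simp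
qed

lemma sum_T_column:
  assumes "b < P" "j < N"
  shows "(\<Sum>\<eta><M. \<Sum>r<P * N. (cmod (T \<eta> r b j))\<^sup>2) = (\<mu> b)\<^sup>2"
proof -
  have "complex_of_real (\<Sum>\<eta><M. \<Sum>r<P * N. (cmod (T \<eta> r b j))\<^sup>2) =
    (\<mu> b)\<^sup>2 * (\<Sum>\<eta><M. \<Sum>r<P * N. cnj (LA \<eta> $$ (r, b * N + j)) * LA \<eta> $$ (r, b * N + j))"
  proof -
    have "complex_of_real ((cmod (T \<eta> r b j))\<^sup>2) =
      of_real ((\<mu> b)\<^sup>2) * (cnj (LA \<eta> $$ (r, b * N + j)) * LA \<eta> $$ (r, b * N + j))" for \<eta> r
      unfolding complex_norm_square T_def by (simp add: power2_eq_square mult_ac)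
    then show ?thesis by (simp only: of_real_sum sum_distrib_left)
  qed
  also have "\<dots> = of_real ((\<mu> b)\<^sup>2)"
    using LA_columns[of "b * N + j" "b * N + j"] assms by (simp add: pair_index_less)
  finally show ?thesis by (simp only: of_real_eq_iff)
qed

lemma sum_mu: "(\<Sum>b<P. (\<mu> b)\<^sup>2) = 1" and mu_nonneg: "b < P \<Longrightarrow> \<mu> b \<ge> 0"
  using schmidt unfolding schmidt_coeffs_def by auto

text \<open>Alice's completeness relation, read in the columns with \<open>j = 0\<close>, returns
  the normalisation of the shared state.\<close>

lemma sum_weight: "(\<Sum>\<eta><M. \<Sum>r<P * N. weight \<eta> r) = 1"
proof -
  have "(\<Sum>\<eta><M. \<Sum>r<P * N. weight \<eta> r) = (\<Sum>b<P. \<Sum>\<eta><M. \<Sum>r<P * N. (cmod (T \<eta> r b 0))\<^sup>2)"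
    unfolding weight_def by (simp only: sum.swap[of _ "{..<P}"])
  also have "\<dots> = (\<Sum>b<P. (\<mu> b)\<^sup>2)"
    using N2 by (intro sum.cong refl) (simp add: sum_T_column)
  finally show ?thesis using sum_mu by simp
qed

text \<open>The \<open>N\<close> columns at Schmidt index \<open>b\<close> each carry total squared
  norm \<open>(\<mu> b)^2\<close>; regrouped by rows they are bounded by the weights, which sum to
  1.\<close>

lemma mu_bound:
  assumes b: "b < P"
  shows "(\<mu> b)\<^sup>2 \<le> 1 / N"
proof -
  have "N * (\<mu> b)\<^sup>2 = (\<Sum>j<N. \<Sum>\<eta><M. \<Sum>r<P * N. (cmod (T \<eta> r b j))\<^sup>2)"
    using b by (simp add: sum_T_column)
  also have "\<dots> = (\<Sum>\<eta><M. \<Sum>r<P * N. \<Sum>j<N. (cmod (T \<eta> r b j))\<^sup>2)"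
    by (subst sum.swap[of _ "{..<M}" "{..<N}"]) (intro sum.cong[OF refl] sum.swap)
  also have "\<dots> \<le> (\<Sum>\<eta><M. \<Sum>r<P * N. weight \<eta> r)"
    using N2 by (intro sum_mono gram_scalar_row_bound[OF T_gram_scalar _ ] b) auto
  finally show ?thesis using N2 sum_weight by (simp add: field_simps)
qed

text \<open>Each nonzero coefficient contributes at most \<open>1 / N\<close> to a total of
  1.\<close>

lemma schmidt_rank: "N \<le> card {i. i < P \<and> \<mu> i \<noteq> 0}"
proof -
  let ?S = "{i. i < P \<and> \<mu> i \<noteq> 0}"
  have "1 = (\<Sum>i\<in>?S. (\<mu> i)\<^sup>2)"
    unfolding sum_mu[symmetric] by (intro sum.mono_neutral_right) auto
  also have "\<dots> \<le> (\<Sum>i\<in>?S. 1 / N)"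
    by (intro sum_mono mu_bound) auto
  also have "\<dots> = card ?S / N" by simp
  finally show ?thesis using N2 by (simp add: field_simps)
qed

lemma N_le_P: "N \<le> P"
proof -
  have "card {i. i < P \<and> \<mu> i \<noteq> 0} \<le> card {..<P}" by (intro card_mono) auto
  then show ?thesis using schmidt_rank by simp
qed

text \<open>With exactly \<open>N\<close> coefficients the slacks in \<open>mu_bound\<close> are
  nonnegative and sum to zero.\<close>

lemma maximally_entangled:
  assumes "P = N" "i < P"
  shows "\<mu> i = 1 / sqrt N"
proof -
  have "(\<Sum>b<P. 1 / N - (\<mu> b)\<^sup>2) = 0"
    using sum_mu assms N2 by (simp add: sum_subtractf)
  then have "1 / N - (\<mu> i)\<^sup>2 = 0"
    using mu_bound assms(2) by (subst (asm) sum_nonneg_eq_0_iff) auto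
  then have "(\<mu> i)\<^sup>2 = (1 / sqrt N)\<^sup>2" by (simp add: power_divide)
  then show ?thesis using mu_nonneg[OF assms(2)] by (simp add: power2_eq_iff_nonneg)
qed

text \<open>A single outcome makes the columns of Alice's operator orthonormal. Weighting the Gram
  values of its rows by column \<open>x\<close> gives \<open>(\<mu> b)^2\<close> at
  \<open>j = 0\<close> and 0 at \<open>j = 1\<close>, yet those values agree for all
  \<open>j\<close>, so every coefficient would vanish.\<close>

lemma classical_communication: "M > 1"
proof (rule ccontr)
  assume "\<not> M > 1"
  then consider "M = 0" | "M = 1" by linarith
  then show False
  proof cases
    case 1
    then show False using sum_weight by simp
  next
    case 2
    have col: "(\<Sum>r<P * N. cnj (LA 0 $$ (r, x)) * LA 0 $$ (r, y)) = (if x = y then 1 else 0)"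
      if "x < P * N" "y < P * N" for x y
      using LA_columns[OF that] 2 by simp
    have "\<mu> b = 0" if b: "b < P" for b
    proof -
      define x where "x = b * N + 0"
      have x: "x < P * N" using b N2 unfolding x_def by (intro pair_index_less) auto
      have proj: "(\<Sum>r<P * N. \<Sum>r'<P * N. LA 0 $$ (r, x) * cnj (LA 0 $$ (r', x)) *
          (\<Sum>d<P. cnj (T 0 r d j) * T 0 r' d j)) = (if j = 0 then (\<mu> b)\<^sup>2 else 0)" (is "?l = _") if j: "j < N" for j
      proof -
        have "?l = (\<Sum>d<P. \<Sum>r<P * N. \<Sum>r'<P * N. (LA 0 $$ (r, x) * cnj (LA 0 $$ (r', x))) * (cnj (T 0 r d j) * T 0 r' d j))"
          by (simp only: sum_distrib_left sum.swap[of _ "{..<P}"])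
        also have "\<dots> = (\<Sum>d<P. (\<mu> d)\<^sup>2 * ((\<Sum>r<P * N. cnj (LA 0 $$ (r, d * N + j)) * LA 0 $$ (r, x)) *
             (\<Sum>r<P * N. cnj (LA 0 $$ (r, x)) * LA 0 $$ (r, d * N + j))))"
          unfolding sum_product by (simp add: T_def sum_distrib_left power2_eq_square mult_ac)
        also have "\<dots> = (\<Sum>d<P. if d = b then if j = 0 then complex_of_real ((\<mu> b)\<^sup>2) else 0 else 0)"
        proof (intro sum.cong refl)
          fix d assume "d \<in> {..<P}"
          then have "d * N + j < P * N" using j by (simp add: pair_index_less)
          moreover have "d * N + j = x \<longleftrightarrow> d = b \<and> j = 0"
            using j N2 unfolding x_def by (intro pair_index_eq_iff) auto
          ultimately show "(\<mu> d)\<^sup>2 * ((\<Sum>r<P * N. cnj (LA 0 $$ (r, d * N + j)) * LA 0 $$ (r, x)) *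
             (\<Sum>r<P * N. cnj (LA 0 $$ (r, x)) * LA 0 $$ (r, d * N + j))) =
             (if d = b then if j = 0 then complex_of_real ((\<mu> b)\<^sup>2) else 0 else 0)"
            using x by (auto simp: col)
        qed
        finally show ?thesis using b by simp
      qed
      \<comment> \<open>The scalar Gram property is taken for all pairs of rows, not only
        \<open>r = r'\<close>; \<open>N \<ge> 2\<close> provides the index
        \<open>j = 1\<close>.\<close>
      have "(\<Sum>d<P. cnj (T 0 r d 0) * T 0 r' d 0) = (\<Sum>d<P. cnj (T 0 r d 1) * T 0 r' d 1)"
        if "r < P * N" "r' < P * N" for r r'
        using T_gram[of 0 r r'] that 2 N2 by force
      then have "complex_of_real ((\<mu> b)\<^sup>2) = 0"
        using proj[of 0] proj[of 1] N2 by simp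
      then show ?thesis by simp
    qed
    then show False using sum_mu by simp
  qed
qed

end

section \<open>Conversion to the maximally entangled state\<close>

lemma of_real_sqrt_mult_self: "complex_of_real (sqrt (real N)) * complex_of_real (sqrt (real N)) = of_nat N"
  by (simp flip: of_real_mult)

lemma kron_schmidt_entry:
  assumes K: "K \<in> carrier_mat n P" and L: "L \<in> carrier_mat n P" and ij: "i < n" "j < n"
  shows "(kron K L *\<^sub>v schmidt_vec P \<mu>) $ (i * n + j) = (\<Sum>b<P. K $$ (i, b) * L $$ (j, b) * \<mu> b)"
proof -
  have KL: "kron K L \<in> carrier_mat (n * n) (P * P)" by (rule kron_carrier[OF K L])
  have "(kron K L *\<^sub>v schmidt_vec P \<mu>) $ (i * n + j) = (\<Sum>x = 0..<P * P. row (kron K L) (i * n + j) $ x * schmidt_vec P \<mu> $ x)"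
    using KL ij by (simp add: scalar_prod_def schmidt_vec_def pair_index_less)
  also have "\<dots> = (\<Sum>x<P * P. kron K L $$ (i * n + j, x) * schmidt_vec P \<mu> $ x)"
    unfolding lessThan_atLeast0 using KL ij by (intro sum.cong refl) (simp add: pair_index_less)
  also have "\<dots> = (\<Sum>b<P. \<Sum>d<P. kron K L $$ (i * n + j, b * P + d) * schmidt_vec P \<mu> $ (b * P + d))"
    by (rule sum_lessThan_prod)
  also have "\<dots> = (\<Sum>b<P. kron K L $$ (i * n + j, b * P + b) * schmidt_vec P \<mu> $ (b * P + b))"
    by (intro sum.cong[OF refl] sum_lessThan_single) (auto simp: schmidt_vec_def pair_index_less)
  also have "\<dots> = (\<Sum>b<P. K $$ (i, b) * L $$ (j, b) * \<mu> b)"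
    by (intro sum.cong refl) (simp add: kron_entry[OF K L ij(1) _ ij(2)] schmidt_vec_def pair_index_less)
  finally show ?thesis .
qed

lemma max_ent_entry:
  assumes "i < N" "j < N"
  shows "max_ent N $ (i * N + j) = (if i = j then 1 / sqrt N else 0)"
  using assms by (simp add: max_ent_def schmidt_vec_def pair_index_less)

lemma (in faithful_protocol) locc_max_ent: "locc_convertible P N (schmidt_vec P \<mu>) (max_ent N)"
proof -
  have N0: "N > 0" using N2 by simp
  \<comment> \<open>\<open>k\<close> encodes the outcome \<open>\<eta>\<close> and a row
    \<open>r\<close>. Conjugation turns the entries of \<open>K\<close>, once multiplied by
    \<open>\<mu> b\<close>, into those of a conjugated \<open>T\<close>; the factor
    \<open>1 / sqrt N\<close> offsets the sum over \<open>N\<close> values of \<open>j\<close> in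
    the completeness relation.\<close>
  define K where "K k = mat N P (\<lambda>(j, b). cnj (LA (k div (P * N)) $$ (k mod (P * N), b * N + j)) / sqrt N)" for k
  have Kc: "K k \<in> carrier_mat N P" for k by (simp add: K_def)
  have "\<exists>L. (\<forall>l<Suc P. L l \<in> carrier_mat N P) \<and>
      msum P P (Suc P) (\<lambda>l. adj (L l) * L l) = 1\<^sub>m P \<and>
      (\<forall>l<Suc P. \<exists>c. kron (K k) (L l) *\<^sub>v schmidt_vec P \<mu> = c \<cdot>\<^sub>v max_ent N)" if k: "k < M * (P * N)" for k
  proof -
    define \<eta> r where "\<eta> = k div (P * N)" and "r = k mod (P * N)"
    have pos: "P * N > 0" using k by (cases "P * N") auto
    have \<eta>r: "\<eta> < M" "r < P * N"
      using k pos by (simp_all add: \<eta>_def r_def less_mult_imp_div_less)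
    obtain L where L: "\<And>l. l < Suc P \<Longrightarrow> L l \<in> carrier_mat N P"
      "msum P P (Suc P) (\<lambda>l. adj (L l) * L l) = 1\<^sub>m P"
      "\<And>l. l < Suc P \<Longrightarrow> \<exists>d. \<forall>i<N. \<forall>j<N. (\<Sum>b<P. cnj (T \<eta> r b i) * L l $$ (j, b)) = (if i = j then d else 0)"
      by (rule gram_scalar_instrument[OF T_gram_scalar[OF \<eta>r] N0]) blast
    have "\<exists>c. kron (K k) (L l) *\<^sub>v schmidt_vec P \<mu> = c \<cdot>\<^sub>v max_ent N" if l: "l < Suc P" for l
    proof -
      obtain d where d: "\<And>i j. i < N \<Longrightarrow> j < N \<Longrightarrow> (\<Sum>b<P. cnj (T \<eta> r b i) * L l $$ (j, b)) = (if i = j then d else 0)"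
        using L(3)[OF l] by blast
      have "kron (K k) (L l) *\<^sub>v schmidt_vec P \<mu> = d \<cdot>\<^sub>v max_ent N"
      proof (rule eq_vecI)
        have dim: "dim_vec (d \<cdot>\<^sub>v max_ent N) = N * N" by (simp add: max_ent_def schmidt_vec_def)
        then show "dim_vec (kron (K k) (L l) *\<^sub>v schmidt_vec P \<mu>) = dim_vec (d \<cdot>\<^sub>v max_ent N)"
          using kron_carrier[OF Kc L(1)[OF l], of k] by simp
        fix x assume "x < dim_vec (d \<cdot>\<^sub>v max_ent N)"
        then have x: "x < N * N" by (simp only: dim)
        define i j where "i = x div N" and "j = x mod N"
        have ij: "i < N" "j < N" "x = i * N + j"
          using x N0 by (simp_all add: i_def j_def less_mult_imp_div_less)
        have "(kron (K k) (L l) *\<^sub>v schmidt_vec P \<mu>) $ x = (\<Sum>b<P. cnj (T \<eta> r b i) * L l $$ (j, b)) / sqrt N"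
          unfolding ij(3) kron_schmidt_entry[OF Kc L(1)[OF l] ij(1,2)] sum_divide_distrib using ij
          by (intro sum.cong refl) (simp add: K_def T_def \<eta>_def r_def)
        also have "\<dots> = d * max_ent N $ x"
          unfolding ij(3) by (simp add: d max_ent_entry ij(1,2))
        finally show "(kron (K k) (L l) *\<^sub>v schmidt_vec P \<mu>) $ x = (d \<cdot>\<^sub>v max_ent N) $ x"
          using x by (simp add: max_ent_def schmidt_vec_def)
      qed
      then show ?thesis ..
    qed
    then show ?thesis using L(1,2) by blast
  qed
  then obtain L where L: "\<And>k. k < M * (P * N) \<Longrightarrow> (\<forall>l<Suc P. L k l \<in> carrier_mat N P) \<and>
      msum P P (Suc P) (\<lambda>l. adj (L k l) * L k l) = 1\<^sub>m P \<and>
      (\<forall>l<Suc P. \<exists>c. kron (K k) (L k l) *\<^sub>v schmidt_vec P \<mu> = c \<cdot>\<^sub>v max_ent N)"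
    by metis
  have "msum P P (M * (P * N)) (\<lambda>k. adj (K k) * K k) = 1\<^sub>m P"
  proof (rule eq_matI)
    fix b d assume "b < dim_row (1\<^sub>m P :: complex mat)" "d < dim_col (1\<^sub>m P :: complex mat)"
    then have bd: "b < P" "d < P" by auto
    have "msum P P (M * (P * N)) (\<lambda>k. adj (K k) * K k) $$ (b, d) = (\<Sum>k<M * (P * N). \<Sum>j<N. cnj (K k $$ (j, b)) * K k $$ (j, d))"
      using bd by (simp add: msum_def adj_mult_self_entry[OF Kc] del: index_mult_mat)
    also have "\<dots> = (\<Sum>\<eta><M. \<Sum>r<P * N. \<Sum>j<N. cnj (LA \<eta> $$ (r, d * N + j)) * LA \<eta> $$ (r, b * N + j) / N)"
      unfolding sum_lessThan_prod[of _ M "P * N"] using bd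
      by (intro sum.cong refl) (simp add: K_def of_real_sqrt_mult_self mult.commute)
    also have "\<dots> = (\<Sum>j<N. (\<Sum>\<eta><M. \<Sum>r<P * N. cnj (LA \<eta> $$ (r, d * N + j)) * LA \<eta> $$ (r, b * N + j)) / N)"
      by (simp only: sum_divide_distrib sum.swap[of _ "{..<N}"])
    also have "\<dots> = (\<Sum>j<N. (if b = d then 1 else 0) / of_nat N :: complex)"
      using bd by (intro sum.cong refl) (subst LA_columns, auto simp: pair_index_less)
    also have "\<dots> = (if b = d then 1 else 0)" using N0 by simp
    finally show "msum P P (M * (P * N)) (\<lambda>k. adj (K k) * K k) $$ (b, d) = 1\<^sub>m P $$ (b, d)"
      using bd by simp
  qed (simp_all add: msum_def)
  then show ?thesis
    unfolding locc_convertible_def using Kc L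
    by (intro exI[of _ "M * (P * N)"] exI[of _ K] exI[of _ "\<lambda>_. Suc P"] exI[of _ L]) blast
qed

section \<open>Teleportation\<close>

definition fourier :: "nat \<Rightarrow> nat \<Rightarrow> nat \<Rightarrow> complex" where
  "fourier N m j = cis (2 * pi * (real m * real j / real N))"

lemma fourier_cnj_same [simp]: "fourier N m j * cnj (fourier N m j) = 1" "cnj (fourier N m j) * fourier N m j = 1"
  by (simp_all add: fourier_def cis_cnj cis_mult)

text \<open>For \<open>j \<noteq> k\<close> this is a geometric sum over an \<open>N\<close>-th root
  of unity, which differs from 1 because \<open>0 < |j - k| < N\<close>.\<close>

lemma fourier_orthogonal:
  assumes "j < N" "k < N"
  shows "(\<Sum>m<N. fourier N m j * cnj (fourier N m k)) = (if j = k then of_nat N else 0)"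
proof (cases "j = k")
  case False
  define x where "x = 2 * pi * ((real j - real k) / real N)"
  have N: "real N > 0" using assms by simp
  have "fourier N m j * cnj (fourier N m k) = cis x ^ m" for m
    unfolding fourier_def cis_cnj cis_mult DeMoivre x_def by (simp add: field_simps diff_divide_distrib)
  then have "(\<Sum>m<N. fourier N m j * cnj (fourier N m k)) = (\<Sum>m<N. cis x ^ m)" by simp
  moreover have "cis x \<noteq> 1"
  proof
    assume "cis x = 1"
    then have "cos x = 1" by (auto simp: complex_eq_iff)
    then obtain n :: int where "x = of_int n * 2 * pi" using cos_one_2pi_int by blast
    then have "2 * pi * ((real j - real k) / real N) = 2 * pi * of_int n"
      by (simp add: x_def mult_ac)
    then have "(real j - real k) / real N = of_int n"
      by (subst (asm) mult_cancel_left) simp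
    then have "real j - real k = of_int n * real N"
      using N by (simp add: field_simps)
    then have "real_of_int (int j - int k) = real_of_int (n * int N)" by simp
    then have eq: "int j - int k = n * int N" by (simp only: of_int_eq_iff)
    then have "int N dvd int j - int k" by simp
    then have "int N \<le> \<bar>int j - int k\<bar>"
      using False by (intro zdvd_imp_le) auto
    then show False using assms by linarith
  qed
  moreover have "cis x ^ N = 1"
  proof -
    have "real N * x = 2 * pi * of_int (int j - int k)"
      unfolding x_def using N by simp
    then show ?thesis unfolding DeMoivre by (simp only: cis_multiple_2pi Ints_of_int)
  qed
  ultimately show ?thesis using False by (simp add: geometric_sum)
qed (use assms in simp)

text \<open>Inverts a cyclic shift; adding \<open>N\<close> first keeps the subtraction from
  truncating.\<close>

lemma mod_shift_iff:
  fixes a k n N :: nat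
  assumes "a < N" "k < N" "n < N"
  shows "k = (a + n) mod N \<longleftrightarrow> n = (k + N - a) mod N"
proof -
  have "(a + n) mod N = (if a + n < N then a + n else a + n - N)"
    using assms by (simp add: mod_if)
  moreover have "(k + N - a) mod N = (if a \<le> k then k - a else k + N - a)"
    using assms by (auto simp: mod_if)
  ultimately show ?thesis using assms by auto
qed

text \<open>
  The outcome \<open>\<eta> = m * N + n\<close> stands for \<open>N\<^sup>-\<^sup>1\<^sup>/\<^sup>2 \<Sum>\<^sub>a exp(2\<pi>i m a / N) |a\<rangle>|a + n mod N\<rangle>\<close>.
\<close>

definition bell :: "nat \<Rightarrow> nat \<Rightarrow> nat \<Rightarrow> complex" where
  "bell N \<eta> x = (if x mod N = (x div N + \<eta> mod N) mod N then fourier N (\<eta> div N) (x div N) / sqrt N else 0)"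

definition bell_projection :: "nat \<Rightarrow> nat \<Rightarrow> complex mat" where
  "bell_projection N \<eta> = mat (N * N) (N * N) (\<lambda>(x, y). bell N \<eta> x * cnj (bell N \<eta> y))"

text \<open>A generalised Pauli correction of b followed by the swap of B and b; the phase is not
  conjugated because the Bell projector already contributes its conjugate.\<close>

definition correction :: "nat \<Rightarrow> nat \<Rightarrow> complex mat" where
  "correction N \<eta> = mat (N * N) (N * N) (\<lambda>(x, y).
     if y div N = x mod N \<and> x div N = (y mod N + \<eta> mod N) mod N then fourier N (\<eta> div N) (y mod N) else 0)"

text \<open>The marginal on Alice's ancilla is uniform; this yields both the unit norm of the Bell
  vector and the trace of what enters the channel.\<close>

lemma bell_norm_row:
  assumes "N > 0" "a < N"
  shows "(\<Sum>k<N. bell N \<eta> (a * N + k) * cnj (bell N \<eta> (a * N + k))) = 1 / N"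
proof -
  have "(\<Sum>k<N. bell N \<eta> (a * N + k) * cnj (bell N \<eta> (a * N + k))) =
     (let k = (a + \<eta> mod N) mod N in bell N \<eta> (a * N + k) * cnj (bell N \<eta> (a * N + k)))"
    unfolding Let_def using assms by (intro sum_lessThan_single) (auto simp: bell_def)
  then show ?thesis using assms by (simp add: bell_def Let_def of_real_sqrt_mult_self)
qed

text \<open>For given \<open>x\<close> only one shift \<open>n\<close> contributes, the one linking
  the two indices of \<open>x\<close>; the sum over \<open>m\<close> is then Fourier
  orthogonality.\<close>

lemma bell_complete:
  assumes "x < N * N" "y < N * N"
  shows "(\<Sum>\<eta><N * N. bell N \<eta> x * cnj (bell N \<eta> y)) = (if x = y then 1 else 0)"
proof -
  have N: "N > 0" using assms by (cases N) auto
  define a k g h where "a = x div N" and "k = x mod N" and "g = y div N" and "h = y mod N"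
  have x: "x = a * N + k" "a < N" "k < N" and y: "y = g * N + h" "g < N" "h < N"
    using assms N by (simp_all add: a_def k_def g_def h_def less_mult_imp_div_less)
  define u where "u = (k + N - a) mod N"
  have u: "u < N" using N by (simp add: u_def)
  have sh: "k = (a + n) mod N \<longleftrightarrow> n = u" if "n < N" for n
    unfolding u_def by (rule mod_shift_iff[OF x(2,3) that])
  have "(\<Sum>\<eta><N * N. bell N \<eta> x * cnj (bell N \<eta> y)) =
    (\<Sum>m<N. \<Sum>n<N. bell N (m * N + n) x * cnj (bell N (m * N + n) y))"
    by (rule sum_lessThan_prod)
  also have "\<dots> = (\<Sum>m<N. bell N (m * N + u) x * cnj (bell N (m * N + u) y))"
    using u x by (intro sum.cong[OF refl] sum_lessThan_single) (auto simp: bell_def sh)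
  also have "\<dots> = (\<Sum>m<N. (if h = (g + u) mod N then 1 / of_nat N else 0) * (fourier N m a * cnj (fourier N m g)))"
    using u x y sh[OF u] by (intro sum.cong refl) (simp add: bell_def of_real_sqrt_mult_self)
  also have "\<dots> = (if h = (g + u) mod N then 1 / of_nat N else 0) * (if a = g then of_nat N else 0)"
    unfolding sum_distrib_left[symmetric] fourier_orthogonal[OF x(2) y(2)] ..
  also have "\<dots> = (if x = y then 1 else 0)"
    using N x y sh[OF u] pair_index_eq_iff[OF x(3) y(3), of a g] by auto
  finally show ?thesis .
qed

lemma bell_projection_carrier [simp]: "bell_projection N \<eta> \<in> carrier_mat (N * N) (N * N)"
  by (simp add: bell_projection_def)

lemma correction_carrier [simp]: "correction N \<eta> \<in> carrier_mat (N * N) (N * N)"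
  by (simp add: correction_def)

lemma adj_bell_projection: "adj (bell_projection N \<eta>) = bell_projection N \<eta>"
  by (rule eq_matI) (auto simp: adj_def bell_projection_def)

lemma bell_projection_idem:
  assumes "N > 0"
  shows "bell_projection N \<eta> * bell_projection N \<eta> = bell_projection N \<eta>"
proof (rule eq_matI)
  fix x y assume "x < dim_row (bell_projection N \<eta>)" "y < dim_col (bell_projection N \<eta>)"
  then have xy: "x < N * N" "y < N * N" by (simp_all add: bell_projection_def)
  have "(\<Sum>z<N * N. bell N \<eta> z * cnj (bell N \<eta> z)) = (\<Sum>a<N. 1 / of_nat N)"
    unfolding sum_lessThan_prod using assms by (intro sum.cong refl) (simp add: bell_norm_row)
  then have 1: "(\<Sum>z<N * N. bell N \<eta> z * cnj (bell N \<eta> z)) = 1" using assms by simp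
  have "(bell_projection N \<eta> * bell_projection N \<eta>) $$ (x, y) =
    bell N \<eta> x * (\<Sum>z<N * N. bell N \<eta> z * cnj (bell N \<eta> z)) * cnj (bell N \<eta> y)"
    unfolding mult_entry[OF bell_projection_carrier bell_projection_carrier xy] sum_distrib_left sum_distrib_right
    using xy by (intro sum.cong refl) (simp add: bell_projection_def mult_ac)
  then show "(bell_projection N \<eta> * bell_projection N \<eta>) $$ (x, y) = bell_projection N \<eta> $$ (x, y)"
    unfolding 1 using xy by (simp add: bell_projection_def)
qed simp_all

lemma correction_entry:
  assumes "i < N" "b < N" "s < N" "c < N"
  shows "correction N \<eta> $$ (i * N + b, s * N + c) =
    (if s = b \<and> c = (i + N - \<eta> mod N) mod N then fourier N (\<eta> div N) c else 0)"
proof -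
  have "\<eta> mod N < N" using assms by simp
  then have "i = (c + \<eta> mod N) mod N \<longleftrightarrow> c = (i + N - \<eta> mod N) mod N"
    using mod_shift_iff[of "\<eta> mod N" N i c] assms by (simp add: add.commute)
  then show ?thesis using assms by (simp add: correction_def pair_index_less)
qed

text \<open>Each row holds exactly one entry, a phase, and distinct rows use distinct columns; for
  square matrices one inverse identity implies the other.\<close>

lemma unitary_correction: "unitary_mat (N * N) (correction N \<eta>)"
proof -
  let ?V = "correction N \<eta>"
  have VV: "?V * adj ?V = 1\<^sub>m (N * N)"
  proof (rule eq_matI)
    fix x y assume "x < dim_row (1\<^sub>m (N * N) :: complex mat)" "y < dim_col (1\<^sub>m (N * N) :: complex mat)"
    then have xy: "x < N * N" "y < N * N" by auto
    have N: "N > 0" using xy by (cases N) auto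
    define i b j d where "i = x div N" and "b = x mod N" and "j = y div N" and "d = y mod N"
    have x: "x = i * N + b" "i < N" "b < N" and y: "y = j * N + d" "j < N" "d < N"
      using xy N by (simp_all add: i_def b_def j_def d_def less_mult_imp_div_less)
    define u where "u i = (i + N - \<eta> mod N) mod N" for i
    have u: "u i < N" for i using N by (simp add: u_def)
    note V = correction_entry[where \<eta> = \<eta> and N = N, folded u_def]
    have inj: "u i = u j \<Longrightarrow> i = j"
      using mod_shift_iff[of "\<eta> mod N" N i "u i"] mod_shift_iff[of "\<eta> mod N" N j "u j"] x y u N
      by (simp add: u_def)
    have "(?V * adj ?V) $$ (x, y) = (\<Sum>s<N. \<Sum>c<N. ?V $$ (x, s * N + c) * cnj (?V $$ (y, s * N + c)))"
      using xy by (subst mult_entry[of _ "N * N" "N * N"]) (simp_all add: adj_entry[OF correction_carrier] sum_lessThan_prod pair_index_less)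
    also have "\<dots> = (\<Sum>c<N. ?V $$ (x, b * N + c) * cnj (?V $$ (y, b * N + c)))"
      unfolding x(1) y(1) using x y by (intro sum_lessThan_single) (simp_all add: V)
    also have "\<dots> = ?V $$ (x, b * N + u i) * cnj (?V $$ (y, b * N + u i))"
      unfolding x(1) y(1) using x y u by (intro sum_lessThan_single) (simp_all add: V)
    also have "\<dots> = (if b = d \<and> u i = u j then 1 else 0)"
      unfolding x(1) y(1) using x y u[of i] by (simp add: V)
    also have "\<dots> = (if x = y then 1 else 0)"
      using inj x y pair_index_eq_iff[OF x(3) y(3), of i j] by auto
    finally show "(?V * adj ?V) $$ (x, y) = 1\<^sub>m (N * N) $$ (x, y)" using xy by simp
  qed (simp_all add: correction_def)
  moreover have "adj ?V * ?V = 1\<^sub>m (N * N)"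
    using mat_mult_left_right_inverse[OF correction_carrier _ VV] by simp
  ultimately show ?thesis unfolding unitary_mat_def by simp
qed

lemma adj_one: "adj (1\<^sub>m n) = 1\<^sub>m n"
  by (rule eq_matI) (auto simp: adj_def)

text \<open>After the Bell projection the matrix on the channel system depends on \<open>a\<close>
  and the outcome only, and all of \<open>\<rho>\<close> sits in the scalar. One factor
  \<open>1 / N\<close> stems from the shared state, the other from the Bell vectors.\<close>

lemma channel_input_bell:
  assumes N: "N > 0" and acd: "a < N" "c < N" "d < N"
  shows "channel_input N (\<lambda>_. 1 / sqrt N) (bell_projection N \<eta>) \<rho> a c d =
    (cnj (fourier N (\<eta> div N) c) * fourier N (\<eta> div N) d *
      \<rho> $$ ((c + \<eta> mod N) mod N, (d + \<eta> mod N) mod N) / (of_nat N * of_nat N)) \<cdot>\<^sub>m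
    mat N N (\<lambda>(k, l). bell N \<eta> (a * N + k) * cnj (bell N \<eta> (a * N + l)))" (is "?X = ?Y")
proof (rule eq_matI)
  fix k l assume "k < dim_row ?Y" "l < dim_col ?Y"
  then have kl: "k < N" "l < N" by simp_all
  let ?v = "bell N \<eta>" and ?n = "\<eta> mod N" and ?F = "fourier N (\<eta> div N)"
  have "?X $$ (k, l) = (\<Sum>i<N. \<Sum>j<N. ?v (a * N + k) * cnj (?v (a * N + l)) / of_nat N *
      (cnj (?v (c * N + i)) * \<rho> $$ (i, j) * ?v (d * N + j)))"
    unfolding channel_input_def using kl acd
    by (simp add: bell_projection_def pair_index_less)
       (intro sum.cong refl, simp add: field_simps of_real_sqrt_mult_self)
  also have "\<dots> = (\<Sum>j<N. ?v (a * N + k) * cnj (?v (a * N + l)) / of_nat N *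
      (cnj (?v (c * N + (c + ?n) mod N)) * \<rho> $$ ((c + ?n) mod N, j) * ?v (d * N + j)))"
    using N by (intro sum_lessThan_single) (auto simp: bell_def)
  also have "\<dots> = ?v (a * N + k) * cnj (?v (a * N + l)) / of_nat N *
      (cnj (?v (c * N + (c + ?n) mod N)) * \<rho> $$ ((c + ?n) mod N, (d + ?n) mod N) * ?v (d * N + (d + ?n) mod N))"
    using N by (intro sum_lessThan_single) (auto simp: bell_def)
  also have "cnj (?v (c * N + (c + ?n) mod N)) = cnj (?F c) / of_real (sqrt N)"
    using N by (simp add: bell_def)
  also have "?v (d * N + (d + ?n) mod N) = ?F d / of_real (sqrt N)"
    using N by (simp add: bell_def)
  finally show "?X $$ (k, l) = ?Y $$ (k, l)"
    using kl by (simp add: of_real_sqrt_mult_self mult_ac)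
qed (simp_all add: channel_input_def)

lemma teleportation:
  assumes N: "N > 0" and eps: "cptp N \<epsilon>"
  shows "det_faithful N N \<epsilon> (\<lambda>_. 1 / sqrt N) (N * N) (bell_projection N) (correction N)"
proof -
  have "\<exists>Q U. projection_mat (N * N) Q \<and> unitary_mat (N * N) U \<and> bell_projection N \<eta> = Q * U" for \<eta>
    by (rule exI[of _ "bell_projection N \<eta>"], rule exI[of _ "1\<^sub>m (N * N)"])
       (simp add: projection_mat_def unitary_mat_def adj_one adj_bell_projection bell_projection_idem[OF N]
         right_mult_one_mat[OF bell_projection_carrier])
  \<comment> \<open>The operators are self-adjoint idempotents, so this one identity serves both
    completeness relations.\<close>
  moreover have "msum (N * N) (N * N) (N * N) (bell_projection N) = 1\<^sub>m (N * N)"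
    by (rule eq_matI) (auto simp: msum_def bell_projection_def bell_complete)
  moreover have "protocol_out N N \<epsilon> (\<lambda>_. 1 / sqrt N) (N * N) (bell_projection N) (correction N) \<rho> = \<rho>"
    if "density N \<rho>" for \<rho>
  proof (rule eq_matI)
    have \<rho>: "\<rho> \<in> carrier_mat N N" using that unfolding density_def psd_def by blast
    then show "dim_row (protocol_out N N \<epsilon> (\<lambda>_. 1 / sqrt N) (N * N) (bell_projection N) (correction N) \<rho>) = dim_row \<rho>"
      "dim_col (protocol_out N N \<epsilon> (\<lambda>_. 1 / sqrt N) (N * N) (bell_projection N) (correction N) \<rho>) = dim_col \<rho>"
      by (simp_all add: protocol_out_def msum_def)
    fix i j assume "i < dim_row \<rho>" "j < dim_col \<rho>"
    then have ij: "i < N" "j < N" using \<rho> by auto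
    define R where "R \<eta> a = mat N N (\<lambda>(k, l). bell N \<eta> (a * N + k) * cnj (bell N \<eta> (a * N + l)))" for \<eta> a
    have R: "R \<eta> a \<in> carrier_mat N N" for \<eta> a by (simp add: R_def)
    have trR: "mtrace (\<epsilon> (R \<eta> a)) = 1 / N" if "a < N" for \<eta> a
      unfolding cptp_trace[OF eps R] using bell_norm_row[OF N that] by (simp add: mtrace_def R_def)
    have branch: "(\<Sum>s<N. \<Sum>c<N. \<Sum>t<N. \<Sum>d<N. correction N \<eta> $$ (i * N + b, s * N + c) *
        \<epsilon> (channel_input N (\<lambda>_. 1 / sqrt N) (bell_projection N \<eta>) \<rho> a c d) $$ (s, t) *
        cnj (correction N \<eta> $$ (j * N + b, t * N + d))) = \<rho> $$ (i, j) / (of_nat N * of_nat N) * \<epsilon> (R \<eta> a) $$ (b, b)"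
      (is "?l = ?r") if ab: "a < N" "b < N" for \<eta> a b
    proof -
      let ?V = "correction N \<eta>" and ?F = "fourier N (\<eta> div N)"
      let ?E = "\<lambda>c d s t. \<epsilon> (channel_input N (\<lambda>_. 1 / sqrt N) (bell_projection N \<eta>) \<rho> a c d) $$ (s, t)"
      define u where "u i = (i + N - \<eta> mod N) mod N" for i
      have u: "u i < N" for i using N by (simp add: u_def)
      have shift: "(u i + \<eta> mod N) mod N = i" if "i < N" for i
        using mod_shift_iff[of "\<eta> mod N" N i "u i"] that u N by (simp add: u_def add.commute)
      note V = correction_entry[where \<eta> = \<eta> and N = N, folded u_def]
      have "?l = (\<Sum>c<N. \<Sum>t<N. \<Sum>d<N. ?V $$ (i * N + b, b * N + c) * ?E c d b t * cnj (?V $$ (j * N + b, t * N + d)))"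
        using ij ab by (intro sum_lessThan_single) (simp_all add: V)
      also have "\<dots> = (\<Sum>t<N. \<Sum>d<N. ?V $$ (i * N + b, b * N + u i) * ?E (u i) d b t * cnj (?V $$ (j * N + b, t * N + d)))"
        using ij ab u by (intro sum_lessThan_single) (simp_all add: V)
      also have "\<dots> = (\<Sum>d<N. ?V $$ (i * N + b, b * N + u i) * ?E (u i) d b b * cnj (?V $$ (j * N + b, b * N + d)))"
        using ij ab by (intro sum_lessThan_single) (simp_all add: V)
      also have "\<dots> = ?V $$ (i * N + b, b * N + u i) * ?E (u i) (u j) b b * cnj (?V $$ (j * N + b, b * N + u j))"
        using ij ab u by (intro sum_lessThan_single) (simp_all add: V)
      also have "\<dots> = ?F (u i) * ?E (u i) (u j) b b * cnj (?F (u j))"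
        using ij ab u by (simp add: V)
      also have "?E (u i) (u j) b b = cnj (?F (u i)) * ?F (u j) * \<rho> $$ (i, j) / (of_nat N * of_nat N) * \<epsilon> (R \<eta> a) $$ (b, b)"
      proof -
        define \<kappa> where "\<kappa> = cnj (?F (u i)) * ?F (u j) * \<rho> $$ (i, j) / (of_nat N * of_nat N)"
        have "channel_input N (\<lambda>_. 1 / sqrt N) (bell_projection N \<eta>) \<rho> a (u i) (u j) = \<kappa> \<cdot>\<^sub>m R \<eta> a"
          unfolding channel_input_bell[OF N ab(1) u u] shift[OF ij(1)] shift[OF ij(2)] \<kappa>_def R_def ..
        \<comment> \<open>A summand with coefficient 0 puts the scalar multiple into the two-term
          shape of \<open>cptp_linear\<close>.\<close>
        also have "\<dots> = \<kappa> \<cdot>\<^sub>m R \<eta> a + 0 \<cdot>\<^sub>m R \<eta> a"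
          by (rule eq_matI) auto
        finally have "\<epsilon> (channel_input N (\<lambda>_. 1 / sqrt N) (bell_projection N \<eta>) \<rho> a (u i) (u j)) =
          \<kappa> \<cdot>\<^sub>m \<epsilon> (R \<eta> a) + 0 \<cdot>\<^sub>m \<epsilon> (R \<eta> a)"
          using cptp_linear[OF eps R R, of \<kappa> \<eta> a 0 \<eta> a] by (simp only:)
        then show ?thesis
          using cptp_carrier[OF eps R, of \<eta> a] ab unfolding \<kappa>_def[symmetric] by simp
      qed
      also have "?F (u i) * (cnj (?F (u i)) * ?F (u j) * \<rho> $$ (i, j) / (of_nat N * of_nat N) * \<epsilon> (R \<eta> a) $$ (b, b)) * cnj (?F (u j)) =
         (?F (u i) * cnj (?F (u i))) * (?F (u j) * cnj (?F (u j))) * ?r"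
        by (simp add: mult_ac del: fourier_cnj_same)
      finally show ?thesis by simp
    qed
    have "protocol_out N N \<epsilon> (\<lambda>_. 1 / sqrt N) (N * N) (bell_projection N) (correction N) \<rho> $$ (i, j) =
      (\<Sum>\<eta><N * N. \<Sum>a<N. \<Sum>b<N. \<rho> $$ (i, j) / (of_nat N * of_nat N) * \<epsilon> (R \<eta> a) $$ (b, b))"
      unfolding protocol_out_entry[OF bell_projection_carrier correction_carrier ij]
      by (intro sum.cong[OF refl] branch) auto
    \<comment> \<open>The sum over \<open>b\<close> is the trace of the channel output, preserved at
      \<open>1 / N\<close>; the \<open>N^3\<close> remaining terms then cancel the factor
      \<open>1 / N^3\<close>.\<close>
    also have "\<dots> = (\<Sum>\<eta><N * N. \<Sum>a<N. \<rho> $$ (i, j) / (of_nat N * of_nat N) * (1 / of_nat N))"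
    proof (intro sum.cong[OF refl])
      fix \<eta> a assume "a \<in> {..<N}"
      then have "1 / of_nat N = (\<Sum>b<N. \<epsilon> (R \<eta> a) $$ (b, b))"
        using trR[of a \<eta>] cptp_carrier[OF eps R, of \<eta> a] by (simp add: mtrace_def)
      then show "(\<Sum>b<N. \<rho> $$ (i, j) / (of_nat N * of_nat N) * \<epsilon> (R \<eta> a) $$ (b, b)) =
         \<rho> $$ (i, j) / (of_nat N * of_nat N) * (1 / of_nat N)"
        by (simp only: sum_distrib_left)
    qed
    also have "\<dots> = \<rho> $$ (i, j)" using N by simp
    finally show "protocol_out N N \<epsilon> (\<lambda>_. 1 / sqrt N) (N * N) (bell_projection N) (correction N) \<rho> $$ (i, j) = \<rho> $$ (i, j)" .
  qed
  ultimately show ?thesis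
    unfolding det_faithful_def adj_bell_projection bell_projection_idem[OF N] using unitary_correction by blast
qed

theorem theorem1:
  fixes N :: nat and \<epsilon> :: "complex mat \<Rightarrow> complex mat"
  assumes "N \<ge> 2"
    and "cptp N \<epsilon>"
    and "\<forall>m K. kraus_rep N \<epsilon> m K \<longrightarrow> N\<^sup>2 \<le> m"
  shows "(\<exists>M LA LB. det_faithful N N \<epsilon> (\<lambda>_. 1 / sqrt (real N)) M LA LB)
       \<and> (\<forall>P \<mu> M LA LB. schmidt_coeffs P \<mu> \<and> det_faithful N P \<epsilon> \<mu> M LA LB \<longrightarrow>
            M > 1 \<and> N \<le> P \<and> N \<le> card {i. i < P \<and> \<mu> i \<noteq> 0} \<and>
            (P = N \<longrightarrow> (\<forall>i<P. \<mu> i = 1 / sqrt (real N))) \<and>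
            (N < P \<longrightarrow> locc_convertible P N (schmidt_vec P \<mu>) (max_ent N)))"
proof (rule conjI)
  show "\<exists>M LA LB. det_faithful N N \<epsilon> (\<lambda>_. 1 / sqrt (real N)) M LA LB"
    using teleportation[of N \<epsilon>] assms(1,2) by (metis less_le_trans pos2)
  show "\<forall>P \<mu> M LA LB. schmidt_coeffs P \<mu> \<and> det_faithful N P \<epsilon> \<mu> M LA LB \<longrightarrow>
            M > 1 \<and> N \<le> P \<and> N \<le> card {i. i < P \<and> \<mu> i \<noteq> 0} \<and>
            (P = N \<longrightarrow> (\<forall>i<P. \<mu> i = 1 / sqrt (real N))) \<and>
            (N < P \<longrightarrow> locc_convertible P N (schmidt_vec P \<mu>) (max_ent N))"
  proof (intro allI impI)
    fix P \<mu> M LA LB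
    assume "schmidt_coeffs P \<mu> \<and> det_faithful N P \<epsilon> \<mu> M LA LB"
    then interpret faithful_protocol N P M \<epsilon> \<mu> LA LB
      using assms by unfold_locales auto
    show "M > 1 \<and> N \<le> P \<and> N \<le> card {i. i < P \<and> \<mu> i \<noteq> 0} \<and>
            (P = N \<longrightarrow> (\<forall>i<P. \<mu> i = 1 / sqrt (real N))) \<and>
            (N < P \<longrightarrow> locc_convertible P N (schmidt_vec P \<mu>) (max_ent N))"
      using classical_communication N_le_P schmidt_rank maximally_entangled locc_max_ent by blast
  qed
qed

end
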